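(* Let $I$ be a monomial ideal in $\Bbbk[\mathbb{N}A]$. Let $$\mathscr{S}=\{F \text{ face of } A\mid I \text{ has a standard pair belonging to } F\}.$$ For $F\in\mathscr{S}$, let $C_F$ be the monomial ideal whose set of standard monomials (the monomials of $\Bbbk[\mathbb{N}A]$ not in $C_F$) consists of all $t^b$ such that $b\in\mathbb{N}A$ divides some element of $a+\mathbb{N}F$ for some standard pair $(a,F)$ of $I$ whose overlap class is maximal with respect to divisibility. Then $I=\bigcap_{F\in\mathscr{S}}C_F$ is an irredundant primary decomposition of $I$. Consequently, (1) $\mathfrak{p}_F$ is associated to $I$ if and only if $I$ has a standard pair that belongs to $F$. (2) $I$ is $\mathfrak{p}_F$-primary if and only if all standard pairs of $I$ belong to $F$.
   Context: Standing assumptions: $\mathbb{N}=\{0,1,2,\dots\}$; $\Bbbk$ is an infinite field; $A=\{a_1,\dots,a_n\}\subset\mathbb{Z}^d\setminus\{0\}$ is a fixed finite set. $\mathbb{N}A$, $\mathbb{Z}A$, $\mathbb{R}_{\ge 0}A$ denote respectively the monoid of nonnegative integer combinations, the group of integer combinations, and the cone of nonnegative real combinations of elements of $A$ (similarly for subsets of $A$). It is assumed that $\mathbb{Z}A=\mathbb{Z}^d$ and that the cone $\mathbb{R}_{\ge 0}A$ is strongly convex (contains no lines). $\Bbbk[\mathbb{N}A]$ is the subring of the Laurent polynomial ring $\Bbbk[t_1^{\pm1},\dots,t_d^{\pm1}]$ with $\Bbbk$-basis the monomials $t^a$, $a\in\mathbb{N}A$. A monomial ideal is an ideal of $\Bbbk[\mathbb{N}A]$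 generated by monomials $t^a$, $a \in \mathbb{N}A$. For $a,a'\in\mathbb{N}A$, $a'$ divides $a$ (equivalently $t^{a'}\mid t^a$) means $a-a'\in\mathbb{N}A$. A face of $A$ is a subset $F\subseteq A$ such that $\mathbb{R}_{\ge0}F$ is a face of the cone $\mathbb{R}_{\ge0}A$ and $\mathbb{R}_{\ge0}F\cap A=F$ (both $F=A$ and $F=\varnothing$, the latter corresponding to the origin, are allowed). For a face $F$, $\mathfrak{p}_F=\langle t^a\mid a\in\mathbb{N}A\setminus\mathbb{N}F\rangle$, a prime monomial ideal. A pair of $A$ is $(a,F)$ with $a\in\mathbb{N}A$ and $F$ a face of $A$; it is said to belong to $F$. Write $(a,F)\prec(b,G)$ if $a+\mathbb{N}F\subseteq b+\mathbb{N}G$. Pairs $(a,F)$ and $(b,F)$ overlap if $a-b\in\mathbb{Z}F$; this is an equivalence relation on pairs, and the class of $(a,F)$, its overlap class, is denoted $[a,F]$. The pair $(a,F)$ divides $(b,G)$ if there is $c\in\mathbb{N}A$ with $a+c+\mathbb{N}F\subseteq b+\mathbb{N}G$; this is well defined on overlap classes and is a partial order on them. For a monomial ideal $I$, $\mathrm{std}(I)=\{a\in\mathbb{N}A\mid t^a\notin I\}$. A proper pair of $I$ is a pair $(a,F)$ with $a+\mathbb{N}F\subseteq\mathrm{std}(I)$. A standard pair of $I$ is a proper pair of $I$ that is maximal with respect to $\prec$ among proper pairs of $I$. An overlap class of standard pairs of $I$ is an overlap class containing at least one standard pair of $I$; it is maximal with respect to divisibility if it divides no other overlap class of standard pairs of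 $I$.
   Formalization: Part (2) is stated for monomial ideals I different from the whole ring: the unit ideal has no standard pairs, so the right-hand side of (2) holds vacuously for every F, although the unit ideal is not primary to any prime p_F. *)

theory Defs
  imports "HOL-Analysis.Polytope" "HOL-Algebra.Ideal" "HOL-Library.Poly_Mapping"
begin

section \<open>Primary ideals and primary decompositions in a commutative ring\<close>

definition radical_ideal :: "('a, 'b) ring_scheme \<Rightarrow> 'a set \<Rightarrow> 'a set" where
  "radical_ideal R I = {x \<in> carrier R. \<exists>n::nat. n > 0 \<and> x [^]\<^bsub>R\<^esub> n \<in> I}"

definition primary_ideal :: "'a set \<Rightarrow> ('a, 'b) ring_scheme \<Rightarrow> bool" where
  "primary_ideal Q R \<longleftrightarrow>
     ideal Q R \<and> Q \<noteq> carrier R \<and>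
     (\<forall>x\<in>carrier R. \<forall>y\<in>carrier R.
        x \<otimes>\<^bsub>R\<^esub> y \<in> Q \<longrightarrow> x \<in> Q \<or> (\<exists>n::nat. n > 0 \<and> y [^]\<^bsub>R\<^esub> n \<in> Q))"

definition primary_to :: "'a set \<Rightarrow> 'a set \<Rightarrow> ('a, 'b) ring_scheme \<Rightarrow> bool" where
  "primary_to P Q R \<longleftrightarrow> primary_ideal Q R \<and> radical_ideal R Q = P"

text \<open>The associated primes of the module \<open>R / I\<close>: the prime ideals that are the annihilator
  of the class of some \<open>f\<close>, that is, of the form \<open>I : f\<close>.\<close>

definition associated_prime :: "'a set \<Rightarrow> 'a set \<Rightarrow> ('a, 'b) ring_scheme \<Rightarrow> bool" where
  "associated_prime P I R \<longleftrightarrow>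
     primeideal P R \<and>
     (\<exists>f\<in>carrier R. P = {g \<in> carrier R. g \<otimes>\<^bsub>R\<^esub> f \<in> I})"

text \<open>The intersection is taken inside \<open>R\<close>, so that the empty intersection is \<open>R\<close> itself.
  Irredundant means that the components have pairwise distinct radicals and that none of them
  may be omitted.\<close>

definition irredundant_primary_decomposition ::
    "'a set \<Rightarrow> 'i set \<Rightarrow> ('i \<Rightarrow> 'a set) \<Rightarrow> ('a, 'b) ring_scheme \<Rightarrow> bool" where
  "irredundant_primary_decomposition I S Q R \<longleftrightarrow>
     finite S \<and>
     (\<forall>i\<in>S. primary_ideal (Q i) R) \<and>
     I = carrier R \<inter> (\<Inter>i\<in>S. Q i) \<and>
     inj_on (\<lambda>i. radical_ideal R (Q i)) S \<and>
     (\<forall>j\<in>S. I \<noteq> carrier R \<inter> (\<Inter>i\<in>S - {j}. Q i))"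


section \<open>Monoid, group and cone generated by a finite set of lattice vectors\<close>

text \<open>These are only meant for finite \<open>F\<close>. For \<open>F = {}\<close> each of them is \<open>{0}\<close>.\<close>

definition NN :: "(int ^ 'd) set \<Rightarrow> (int ^ 'd) set" where
  "NN F = {\<Sum>a\<in>F. int (c a) *s a | c :: int ^ 'd \<Rightarrow> nat. True}"

definition ZZ :: "(int ^ 'd) set \<Rightarrow> (int ^ 'd) set" where
  "ZZ F = {\<Sum>a\<in>F. c a *s a | c :: int ^ 'd \<Rightarrow> int. True}"

definition real_vec :: "int ^ 'd \<Rightarrow> real ^ 'd" where
  "real_vec a = (\<chi> i. real_of_int (a $ i))"

definition cone_gen :: "(int ^ 'd) set \<Rightarrow> (real ^ 'd) set" where
  "cone_gen F =
     {\<Sum>a\<in>F. c a *\<^sub>R real_vec a | c :: int ^ 'd \<Rightarrow> real. \<forall>a\<in>F. 0 \<le> c a}"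

definition strongly_convex :: "(real ^ 'd) set \<Rightarrow> bool" where
  "strongly_convex K \<longleftrightarrow> \<not> (\<exists>x v. v \<noteq> 0 \<and> (\<forall>t::real. x + t *\<^sub>R v \<in> K))"

text \<open>The empty set is a \<open>face_of\<close> every convex set, but \<open>cone_gen F\<close> always contains the
  origin, so \<open>F = {}\<close> stands for the face \<open>{0}\<close>.\<close>

definition is_face :: "(int ^ 'd) set \<Rightarrow> (int ^ 'd) set \<Rightarrow> bool" where
  "is_face A F \<longleftrightarrow>
     F \<subseteq> A \<and> cone_gen F face_of cone_gen A \<and> {a \<in> A. real_vec a \<in> cone_gen F} = F"


section \<open>The affine semigroup ring and its monomial ideals\<close>

text \<open>The type \<open>int ^ 'd \<Rightarrow>\<^sub>0 'k\<close> with its convolution product is the Laurent polynomial ring in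
  \<open>CARD('d)\<close> variables over \<open>'k\<close>. The semigroup ring consists of the Laurent polynomials with
  exponents in \<open>NN A\<close>.\<close>

definition semigroup_ring :: "(int ^ 'd) set \<Rightarrow> (int ^ 'd \<Rightarrow>\<^sub>0 'k::field) ring" where
  "semigroup_ring A =
     \<lparr>carrier = {p. Poly_Mapping.keys p \<subseteq> NN A}, mult = (*), one = 1, zero = 0, add = (+)\<rparr>"

definition mon :: "int ^ 'd \<Rightarrow> (int ^ 'd \<Rightarrow>\<^sub>0 'k::field)" where
  "mon a = Poly_Mapping.single a 1"

definition monomial_ideal :: "(int ^ 'd) set \<Rightarrow> (int ^ 'd \<Rightarrow>\<^sub>0 'k::field) set \<Rightarrow> bool" where
  "monomial_ideal A I \<longleftrightarrow> (\<exists>B \<subseteq> NN A. I = Idl\<^bsub>semigroup_ring A\<^esub> (mon ` B))"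

definition face_prime ::
    "(int ^ 'd) set \<Rightarrow> (int ^ 'd) set \<Rightarrow> (int ^ 'd \<Rightarrow>\<^sub>0 'k::field) set" where
  "face_prime A F = Idl\<^bsub>semigroup_ring A\<^esub> (mon ` (NN A - NN F))"

definition std :: "(int ^ 'd) set \<Rightarrow> (int ^ 'd \<Rightarrow>\<^sub>0 'k::field) set \<Rightarrow> (int ^ 'd) set" where
  "std A I = {a \<in> NN A. mon a \<notin> I}"


section \<open>Standard pairs and overlap classes\<close>

type_synonym 'd pair = "(int ^ 'd) \<times> (int ^ 'd) set"

definition is_pair :: "(int ^ 'd) set \<Rightarrow> 'd::finite pair \<Rightarrow> bool" where
  "is_pair A p \<longleftrightarrow> fst p \<in> NN A \<and> is_face A (snd p)"

definition pair_set :: "'d::finite pair \<Rightarrow> (int ^ 'd) set" where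
  "pair_set p = {fst p + f | f. f \<in> NN (snd p)}"

definition proper_pair ::
    "(int ^ 'd) set \<Rightarrow> (int ^ 'd \<Rightarrow>\<^sub>0 'k::field) set \<Rightarrow> 'd::finite pair \<Rightarrow> bool" where
  "proper_pair A I p \<longleftrightarrow> is_pair A p \<and> pair_set p \<subseteq> std A I"

definition standard_pair ::
    "(int ^ 'd) set \<Rightarrow> (int ^ 'd \<Rightarrow>\<^sub>0 'k::field) set \<Rightarrow> 'd::finite pair \<Rightarrow> bool" where
  "standard_pair A I p \<longleftrightarrow>
     proper_pair A I p \<and> (\<forall>q. proper_pair A I q \<and> pair_set p \<subseteq> pair_set q \<longrightarrow> q = p)"

definition overlap :: "'d::finite pair \<Rightarrow> 'd::finite pair \<Rightarrow> bool" where
  "overlap p q \<longleftrightarrow> snd p = snd q \<and> fst p - fst q \<in> ZZ (snd p)"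

definition overlap_class :: "(int ^ 'd) set \<Rightarrow> 'd::finite pair \<Rightarrow> 'd::finite pair set" where
  "overlap_class A p = {q. is_pair A q \<and> overlap p q}"

definition pair_divides :: "(int ^ 'd) set \<Rightarrow> 'd::finite pair \<Rightarrow> 'd::finite pair \<Rightarrow> bool" where
  "pair_divides A p q \<longleftrightarrow> (\<exists>c\<in>NN A. (\<lambda>x. c + x) ` pair_set p \<subseteq> pair_set q)"

text \<open>Divisibility of pairs does not depend on the representatives of the overlap classes, so
  asking for some representatives is the same as asking for all of them.\<close>

definition class_divides :: "(int ^ 'd) set \<Rightarrow> 'd::finite pair set \<Rightarrow> 'd::finite pair set \<Rightarrow> bool" where
  "class_divides A X Y \<longleftrightarrow> (\<exists>p\<in>X. \<exists>q\<in>Y. pair_divides A p q)"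

definition standard_classes ::
    "(int ^ 'd) set \<Rightarrow> (int ^ 'd \<Rightarrow>\<^sub>0 'k::field) set \<Rightarrow> 'd::finite pair set set" where
  "standard_classes A I = {overlap_class A p | p. standard_pair A I p}"

definition maximal_class ::
    "(int ^ 'd) set \<Rightarrow> (int ^ 'd \<Rightarrow>\<^sub>0 'k::field) set \<Rightarrow> 'd::finite pair set \<Rightarrow> bool" where
  "maximal_class A I X \<longleftrightarrow>
     X \<in> standard_classes A I \<and>
     (\<forall>Y\<in>standard_classes A I. class_divides A X Y \<longrightarrow> Y = X)"

definition standard_faces ::
    "(int ^ 'd) set \<Rightarrow> (int ^ 'd \<Rightarrow>\<^sub>0 'k::field) set \<Rightarrow> (int ^ 'd) set set" where
  "standard_faces A I = {F. is_face A F \<and> (\<exists>a. standard_pair A I (a, F))}"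

text \<open>A monomial ideal is determined by its standard monomials, and the set of exponents below is
  closed under divisors in \<open>NN A\<close>, so there is exactly one such ideal.\<close>

definition face_component ::
    "(int ^ 'd) set \<Rightarrow> (int ^ 'd \<Rightarrow>\<^sub>0 'k::field) set \<Rightarrow> (int ^ 'd) set \<Rightarrow> (int ^ 'd \<Rightarrow>\<^sub>0 'k) set" where
  "face_component A I F =
     (THE J. monomial_ideal A J \<and>
        std A J = {b \<in> NN A. \<exists>a. standard_pair A I (a, F) \<and>
                     maximal_class A I (overlap_class A (a, F)) \<and>
                     (\<exists>x\<in>pair_set (a, F). x - b \<in> NN A)})"

end

theory Submission
  imports Defs "HOL-Analysis.Kronecker_Approximation_Theorem"
begin

text \<open>
A monomial ideal \<open>I\<close> is the span of the monomials whose exponents lie outside the set \<open>S\<close> of its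
standard exponents, so decomposing \<open>I\<close> means covering \<open>S\<close> by divisor-closed pieces. For a face \<open>F\<close>
call \<open>b\<close> a base point if \<open>b + NN F \<subseteq> S\<close>.

Base points for \<open>F\<close> are closed under division even modulo the group \<open>ZZ F\<close> (\<open>bases_saturated\<close>). Hence
if the class of a standard pair \<open>(a, F)\<close> divides that of \<open>(b, G)\<close>, then \<open>a\<close> is a base point for \<open>G\<close>, and
maximality of \<open>(a, F)\<close> gives \<open>G = F\<close>: divisibility only compares classes that belong to the same face
(\<open>class_divides_iff\<close>). Moreover a standard pair leaves the base points for \<open>F\<close> after finitely many steps
in the direction of any \<open>c \<in> A - F\<close>, since otherwise the pair could be extended to a larger face
(\<open>isolated_escape\<close>). This and Dickson's lemma show that only finitely many overlap classes of standard
pairs belong to \<open>F\<close> (\<open>finitely_many_isolated_classes\<close>), so each of them divides a maximal one.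

It follows that the components cover \<open>S\<close> (\<open>std_eq_Union_components\<close>). The standard exponents of the
component of \<open>F\<close> are stable under adding \<open>NN F\<close>, and no exponent \<open>c\<close> outside \<open>NN F\<close> has all its multiples
among them, because a degree that vanishes exactly on \<open>F\<close> is bounded there
(\<open>component_std_power_escape\<close>). For ideals spanned by monomials these two properties imply being
primary to \<open>face_prime A F\<close> (\<open>monomial_primary\<close>). No component is redundant, because far inside
\<open>a + NN F\<close>, for a standard pair \<open>(a, F)\<close>, there are points that belong to no other component
(\<open>component_std_not_covered\<close>).

If the class of \<open>(a, F)\<close> is maximal, then going from \<open>a\<close> in a direction outside \<open>F\<close> leaves the base
points, and a translate of \<open>a\<close> by an element of \<open>NN F\<close> gives a monomial whose annihilator modulo \<open>I\<close> is
\<open>face_prime A F\<close> (\<open>standard_face_associated\<close>). That no other face prime is associated follows from the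
decomposition (\<open>associated_standard_face\<close>).

The geometry of the cone enters through \<open>is_face_iff\<close>, which describes faces within the monoid, and
\<open>face_functional\<close>, which provides the degrees. Both rest on the fact that real linear relations between
lattice vectors can be replaced by integer relations with the same signs
(\<open>integer_relation_of_real_relation\<close>).
\<close>

section \<open>Monoids and groups generated by lattice vectors\<close>

lemma NN_I: "(\<Sum>a\<in>F. int (n a) *s a) \<in> NN F"
  unfolding NN_def by blast

lemma NN_E:
  assumes "x \<in> NN F"
  obtains n where "x = (\<Sum>a\<in>F. int (n a) *s a)"
  using assms unfolding NN_def by blast

lemma zero_NN [simp]: "0 \<in> NN F"
  using NN_I[where F = F and n = "\<lambda>_. 0"] by simp

lemma NN_empty [simp]: "NN {} = {0}"
  by (auto simp: NN_def)

lemma NN_add: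
  assumes "x \<in> NN F" "y \<in> NN F"
  shows "x + y \<in> NN F"
proof -
  obtain n m where "x = (\<Sum>a\<in>F. int (n a) *s a)" "y = (\<Sum>a\<in>F. int (m a) *s a)"
    using assms by (auto elim!: NN_E)
  then have "x + y = (\<Sum>a\<in>F. int (n a + m a) *s a)"
    by (simp add: sum.distrib vector_sadd_rdistrib)
  then show ?thesis
    using NN_I[where n = "\<lambda>a. n a + m a"] by simp
qed

lemma NN_sum:
  assumes "\<And>i. i \<in> J \<Longrightarrow> f i \<in> NN F"
  shows "sum f J \<in> NN F"
  using assms by (induction J rule: infinite_finite_induct) (auto simp: NN_add)

lemma NN_scale:
  assumes "x \<in> NN F"
  shows "int n *s x \<in> NN F"
  by (induction n) (auto simp: vector_sadd_rdistrib NN_add assms)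

lemma NN_gen:
  assumes "finite F" "a \<in> F"
  shows "a \<in> NN F"
proof -
  have "(\<Sum>b\<in>F. int (if b = a then 1 else 0) *s b) = (\<Sum>b\<in>F. if b = a then b else 0)"
    by (rule sum.cong) auto
  then have "(\<Sum>b\<in>F. int (if b = a then 1 else 0) *s b) = a"
    using assms by simp
  then show ?thesis
    using NN_I[where F = F and n = "\<lambda>b. if b = a then 1 else 0"] by simp
qed

lemma NN_least:
  assumes "x \<in> NN F" "P 0" "\<And>x y. P x \<Longrightarrow> P y \<Longrightarrow> P (x + y)" "\<And>a. a \<in> F \<Longrightarrow> P a"
  shows "P x"
proof -
  obtain n where x: "x = (\<Sum>a\<in>F. int (n a) *s a)"
    using assms(1) by (rule NN_E)
  have "P (int m *s a)" if "a \<in> F" for m a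
    by (induction m) (auto simp: vector_sadd_rdistrib assms that)
  then have "P (\<Sum>a\<in>G. int (n a) *s a)" if "G \<subseteq> F" for G
    using that by (induction G rule: infinite_finite_induct) (auto simp: assms)
  then show ?thesis
    using x by blast
qed

lemma NN_mono:
  assumes "F \<subseteq> G" "finite G"
  shows "NN F \<subseteq> NN G"
proof
  fix x assume "x \<in> NN F"
  then show "x \<in> NN G"
    by (rule NN_least) (use assms NN_gen NN_add in auto)
qed

lemma ZZ_eq: "ZZ F = {x - y | x y. x \<in> NN F \<and> y \<in> NN F}"
proof (intro equalityI subsetI)
  fix x assume "x \<in> ZZ F"
  then obtain c where c: "x = (\<Sum>a\<in>F. c a *s a)"
    unfolding ZZ_def by blast
  have "c a *s a = int (nat (c a)) *s a - int (nat (- c a)) *s a" for a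
    by (simp add: vec_eq_iff algebra_simps)
  then have "x = (\<Sum>a\<in>F. int (nat (c a)) *s a) - (\<Sum>a\<in>F. int (nat (- c a)) *s a)"
    unfolding c sum_subtractf[symmetric] by (intro sum.cong refl)
  then show "x \<in> {x - y | x y. x \<in> NN F \<and> y \<in> NN F}"
    using NN_I[where F = F and n = "\<lambda>a. nat (c a)"] NN_I[where F = F and n = "\<lambda>a. nat (- c a)"]
    by blast
next
  fix z assume "z \<in> {x - y | x y. x \<in> NN F \<and> y \<in> NN F}"
  then obtain n m where "z = (\<Sum>a\<in>F. int (n a) *s a) - (\<Sum>a\<in>F. int (m a) *s a)"
    by (auto elim!: NN_E)
  then have "z = (\<Sum>a\<in>F. (int (n a) - int (m a)) *s a)"
    by (simp add: sum_subtractf vector_sub_rdistrib)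
  then show "z \<in> ZZ F"
    unfolding ZZ_def by (intro CollectI exI[where x = "\<lambda>a. int (n a) - int (m a)"]) simp
qed

lemma ZZ_diff: "x \<in> NN F \<Longrightarrow> y \<in> NN F \<Longrightarrow> x - y \<in> ZZ F"
  unfolding ZZ_eq by blast

lemma NN_ZZ: "x \<in> NN F \<Longrightarrow> x \<in> ZZ F"
  using ZZ_diff[where x = x and y = 0 and F = F] by simp

lemma ZZ_uminus: "x \<in> ZZ F \<Longrightarrow> - x \<in> ZZ F"
  unfolding ZZ_eq by force

lemma ZZ_minus_commute: "x - y \<in> ZZ F \<Longrightarrow> y - x \<in> ZZ F"
  using ZZ_uminus[where x = "x - y"] by simp

lemma ZZ_add:
  assumes "x \<in> ZZ F" "y \<in> ZZ F"
  shows "x + y \<in> ZZ F"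
proof -
  obtain a b c d where "x = a - b" "y = c - d" "a \<in> NN F" "b \<in> NN F" "c \<in> NN F" "d \<in> NN F"
    using assms unfolding ZZ_eq by blast
  then have "x + y = (a + c) - (b + d)" "a + c \<in> NN F" "b + d \<in> NN F"
    by (auto simp: NN_add)
  then show ?thesis
    unfolding ZZ_eq by blast
qed

lemma ZZ_sub: "x \<in> ZZ F \<Longrightarrow> y \<in> ZZ F \<Longrightarrow> x - y \<in> ZZ F"
  using ZZ_add[of x F "- y"] ZZ_uminus[of y F] by simp

section \<open>Integer relations from real relations\<close>

lemma real_vec_0 [simp]: "real_vec 0 = 0"
  by (simp add: real_vec_def vec_eq_iff)

lemma real_vec_add: "real_vec (x + y) = real_vec x + real_vec y"
  by (simp add: real_vec_def vec_eq_iff)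

lemma real_vec_sum: "real_vec (sum f J) = (\<Sum>j\<in>J. real_vec (f j))"
  by (induction J rule: infinite_finite_induct) (auto simp: real_vec_add)

lemma real_vec_scale: "real_vec (c *s x) = of_int c *\<^sub>R real_vec x"
  by (simp add: real_vec_def vec_eq_iff)

lemma real_vec_inject [simp]: "real_vec x = real_vec y \<longleftrightarrow> x = y"
  by (simp add: real_vec_def vec_eq_iff)

text \<open>Simultaneous Dirichlet approximation yields integers \<open>p a\<close> so close to a common multiple of
  the real coefficients \<open>v a\<close> that the integer vector \<open>\<Sum>a. p a *s a\<close> has all its coordinates
  smaller than \<open>1\<close>, hence vanishes. This is how statements about the real cone are brought down to
  statements about the monoid.\<close>

lemma integer_relation_of_real_relation:
  assumes "finite A" and rel: "(\<Sum>a\<in>A. v a *\<^sub>R real_vec a) = 0"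
  obtains p :: "int ^ 'd \<Rightarrow> int" where
    "(\<Sum>a\<in>A. p a *s a) = 0" "\<And>a. a \<in> A \<Longrightarrow> sgn (of_int (p a)) = sgn (v a :: real)"
proof -
  define M where "M = (\<Sum>a\<in>A. \<Sum>i\<in>UNIV. \<bar>real_of_int (a $ i)\<bar>)"
  define W where "W = (\<Sum>a\<in>A. if v a = 0 then 0 else 1 / \<bar>v a\<bar>)"
  have M0: "0 \<le> M" and W0: "0 \<le> W"
    unfolding M_def W_def by (auto intro!: sum_nonneg)
  \<comment> \<open>\<open>N > M\<close> makes the integer vector below smaller than \<open>1\<close>; \<open>N > W\<close> makes the error \<open>1 / N\<close> too small
      to change the sign of a nonzero coefficient.\<close>
  obtain N :: nat where N: "1 + M + W < real N"
    using reals_Archimedean2 by blast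
  then have Npos: "0 < N"
    using M0 W0 by (cases N) auto
  have vN: "1 / real N \<le> \<bar>v a\<bar>" if "a \<in> A" "v a \<noteq> 0" for a
  proof -
    have "1 / \<bar>v a\<bar> = (if v a = 0 then 0 else 1 / \<bar>v a\<bar>)"
      using that by simp
    also have "\<dots> \<le> W"
      unfolding W_def using \<open>finite A\<close> that(1)
      by (intro member_le_sum) auto
    also have "\<dots> \<le> real N"
      using N M0 by linarith
    finally show ?thesis
      using that Npos by (simp add: field_simps)
  qed
  obtain e where e: "bij_betw e {..<card A} A"
    using \<open>finite A\<close> ex_bij_betw_nat_finite[of A] by (auto simp: atLeast0LessThan)
  obtain q r where q: "0 < q" "\<And>i. i < card A \<Longrightarrow> \<bar>of_int q * v (e i) - of_int (r i)\<bar> < 1 / N"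
    using Dirichlet_approx_simult[of N "card A" "\<lambda>i. v (e i)"] Npos by metis
  define p where "p a = r (inv_into {..<card A} e a)" for a
  have close: "\<bar>of_int q * v a - of_int (p a)\<bar> < 1 / N" if "a \<in> A" for a
  proof -
    have "inv_into {..<card A} e a < card A" "e (inv_into {..<card A} e a) = a"
      using e that bij_betw_inv_into_right[OF e that] inv_into_into[of a e "{..<card A}"]
      by (auto simp: bij_betw_def)
    then show ?thesis
      using q(2)[of "inv_into {..<card A} e a"] by (simp add: p_def)
  qed
  have "(\<Sum>a\<in>A. p a *s a) $ i = 0" for i
  proof -
    have "(\<Sum>a\<in>A. v a * real_of_int (a $ i)) = 0"
      using rel by (simp add: vec_eq_iff real_vec_def)
    then have "(\<Sum>a\<in>A. of_int q * v a * real_of_int (a $ i)) = 0"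
      by (simp add: sum_distrib_left[symmetric] mult.assoc)
    then have "real_of_int ((\<Sum>a\<in>A. p a *s a) $ i)
        = (\<Sum>a\<in>A. (of_int (p a) - of_int q * v a) * real_of_int (a $ i))"
      by (simp add: left_diff_distrib sum_subtractf)
    also have "\<bar>\<dots>\<bar> \<le> (\<Sum>a\<in>A. 1 / N * (\<Sum>i\<in>UNIV. \<bar>real_of_int (a $ i)\<bar>))"
    proof (rule order_trans[OF sum_abs], rule sum_mono)
      fix a assume "a \<in> A"
      have "\<bar>real_of_int (a $ i)\<bar> \<le> (\<Sum>i\<in>UNIV. \<bar>real_of_int (a $ i)\<bar>)"
        by (intro member_le_sum) auto
      then show "\<bar>(of_int (p a) - of_int q * v a) * real_of_int (a $ i)\<bar>
          \<le> 1 / N * (\<Sum>i\<in>UNIV. \<bar>real_of_int (a $ i)\<bar>)"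
        unfolding abs_mult using close[OF \<open>a \<in> A\<close>] by (intro mult_mono) auto
    qed
    also have "\<dots> = M / N"
      by (simp add: M_def sum_divide_distrib)
    also have "\<dots> < 1"
      using N Npos W0 by simp
    finally show ?thesis
      by linarith
  qed
  then have "(\<Sum>a\<in>A. p a *s a) = 0"
    by (simp add: vec_eq_iff)
  moreover have "sgn (of_int (p a)) = sgn (v a)" if "a \<in> A" for a
  proof -
    have c: "\<bar>of_int q * v a - of_int (p a)\<bar> < 1 / N"
      using close that .
    have N1: "1 / real N \<le> 1"
      using Npos by simp
    have *: "\<bar>v a\<bar> \<le> of_int q * \<bar>v a\<bar>"
      using q(1) by (simp add: mult_le_cancel_right1)
    consider "v a = 0" | "v a > 0" | "v a < 0"
      by linarith
    then show ?thesis
    proof cases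
      case 1
      then have "\<bar>real_of_int (p a)\<bar> < 1"
        using c N1 by simp
      then have "p a = 0"
        by linarith
      then show ?thesis
        using 1 by simp
    next
      case 2
      then have "1 / N \<le> of_int q * v a"
        using vN[OF that] * unfolding abs_of_pos[OF 2] by linarith
      then have "0 < real_of_int (p a)"
        using c by linarith
      then show ?thesis
        using 2 by simp
    next
      case 3
      then have "1 / N \<le> - (of_int q * v a)"
        using vN[OF that] * unfolding abs_of_neg[OF 3] mult_minus_right by linarith
      then have "real_of_int (p a) < 0"
        using c by linarith
      then show ?thesis
        using 3 by (simp add: sgn_if)
    qed
  qed
  ultimately show thesis
    using that by blast
qed

section \<open>Faces of the cone as faces of the monoid\<close>

locale affine_semigroup =
  fixes A :: "(int ^ 'd) set"
  assumes finite_A: "finite A"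
    and zero_notin_A: "0 \<notin> A"
    and pointed: "strongly_convex (cone_gen A)"
begin

abbreviation Q :: "(int ^ 'd) set" where "Q \<equiv> NN A"

text \<open>If \<open>v b\<close> were positive, the relation would write a negative multiple of \<open>b\<close> as a nonnegative
combination of \<open>A\<close>, and the cone would contain the whole line through \<open>b\<close>.\<close>

lemma nonneg_relation_trivial:
  assumes rel: "(\<Sum>a\<in>A. v a *\<^sub>R real_vec a) = 0"
    and nonneg: "\<And>a. a \<in> A \<Longrightarrow> 0 \<le> v a" and "b \<in> A"
  shows "v b = 0"
proof (rule ccontr)
  assume "v b \<noteq> 0"
  then have vb: "0 < v b"
    using nonneg[OF \<open>b \<in> A\<close>] by simp
  have "0 + t *\<^sub>R real_vec b \<in> cone_gen A" for t
  proof -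
    define c where "c a = \<bar>t\<bar> / v b * v a + (if a = b then t else 0)" for a
    have "(\<Sum>a\<in>A. c a *\<^sub>R real_vec a)
        = (\<bar>t\<bar> / v b) *\<^sub>R (\<Sum>a\<in>A. v a *\<^sub>R real_vec a) + (\<Sum>a\<in>A. if a = b then t *\<^sub>R real_vec b else 0)"
      unfolding c_def scaleR_sum_right sum.distrib[symmetric]
      by (intro sum.cong refl) (simp add: scaleR_add_left)
    then have "0 + t *\<^sub>R real_vec b = (\<Sum>a\<in>A. c a *\<^sub>R real_vec a)"
      using rel \<open>b \<in> A\<close> finite_A by simp
    moreover have "\<forall>a\<in>A. 0 \<le> c a"
      using vb nonneg by (auto simp: c_def)
    ultimately show ?thesis
      unfolding cone_gen_def by blast
  qed
  moreover have "real_vec b \<noteq> 0"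
    using \<open>b \<in> A\<close> zero_notin_A by (metis real_vec_0 real_vec_inject)
  ultimately show False
    using pointed unfolding strongly_convex_def by blast
qed

text \<open>The form of \<open>is_face\<close> that lives in the monoid alone. Everything after \<open>is_face_iff\<close> is expressed
with it, so that cones no longer occur.\<close>

definition divisor_closed_face :: "(int ^ 'd) set \<Rightarrow> bool" where
  "divisor_closed_face F \<longleftrightarrow> F \<subseteq> A \<and> (\<forall>a\<in>A. \<forall>x\<in>Q. a + x \<in> NN F \<longrightarrow> a \<in> F)"

text \<open>By \<open>integer_relation_of_real_relation\<close> the coefficients may be taken integral with the same signs.
If \<open>v b > 0\<close>, moving the negative terms, which all belong to \<open>F\<close>, to the other side gives
\<open>b + x = y\<close> with \<open>x\<close> in the monoid and \<open>y\<close> in \<open>NN F\<close>, so \<open>b\<close> would be in \<open>F\<close>.\<close>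

lemma divisor_closed_face_relation:
  assumes F: "divisor_closed_face F"
    and rel: "(\<Sum>a\<in>A. v a *\<^sub>R real_vec a) = 0"
    and nonneg: "\<And>a. a \<in> A - F \<Longrightarrow> 0 \<le> v a" and b: "b \<in> A - F"
  shows "v b = 0"
proof (rule ccontr)
  assume "v b \<noteq> 0"
  obtain p where p: "(\<Sum>a\<in>A. p a *s a) = 0"
      "\<And>a. a \<in> A \<Longrightarrow> sgn (real_of_int (p a)) = sgn (v a)"
    using integer_relation_of_real_relation[OF finite_A rel] by blast
  have p0: "0 \<le> p a" if "a \<in> A - F" for a
    using p(2)[of a] nonneg[of a] that by (auto simp: sgn_if split: if_splits)
  have pb: "0 < p b"
    using p(2)[of b] nonneg[of b] b \<open>v b \<noteq> 0\<close> by (auto simp: sgn_if split: if_splits)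
  define x where "x = (\<Sum>a\<in>A. int (if a = b then nat (p a - 1) else nat (p a)) *s a)"
  define y where "y = (\<Sum>a\<in>F. int (nat (- p a)) *s a)"
  have "F \<subseteq> A"
    using F by (simp add: divisor_closed_face_def)
  then have y: "y = (\<Sum>a\<in>A. if a \<in> F then int (nat (- p a)) *s a else 0)"
    unfolding y_def by (simp add: sum.inter_restrict[OF finite_A, symmetric] inf.absorb_iff2)
  have "b = (\<Sum>a\<in>A. if a = b then a else 0)"
    using b finite_A by simp
  then have "b + x - y = (\<Sum>a\<in>A. (if a = b then a else 0)
      + int (if a = b then nat (p a - 1) else nat (p a)) *s a
      - (if a \<in> F then int (nat (- p a)) *s a else 0))"
    unfolding x_def y sum.distrib sum_subtractf by simp
  also have "\<dots> = (\<Sum>a\<in>A. p a *s a)"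
  proof (rule sum.cong[OF refl])
    fix a assume "a \<in> A"
    consider "a = b" | "a \<noteq> b" "a \<in> F" | "a \<noteq> b" "a \<notin> F"
      by blast
    then show "(if a = b then a else 0) + int (if a = b then nat (p a - 1) else nat (p a)) *s a
      - (if a \<in> F then int (nat (- p a)) *s a else 0) = p a *s a"
    proof cases
      case 1
      show ?thesis
        unfolding 1 using b pb by (auto simp: vec_eq_iff algebra_simps)
    qed (use p0[of a] \<open>a \<in> A\<close> in \<open>auto simp: vec_eq_iff algebra_simps\<close>)
  qed
  finally have "b + x = y"
    using p(1) by simp
  moreover have "x \<in> Q" "y \<in> NN F"
    unfolding x_def y_def by (rule NN_I)+
  ultimately have "b \<in> F"
    using F b unfolding divisor_closed_face_def by blast
  then show False
    using b by blast
qed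

lemma sum_restrict_coefficients:
  assumes "F \<subseteq> A"
  shows "(\<Sum>a\<in>A. (if a \<in> F then c a else 0) *\<^sub>R real_vec a) = (\<Sum>a\<in>F. c a *\<^sub>R real_vec a)"
proof -
  have "(\<Sum>a\<in>A. (if a \<in> F then c a else 0) *\<^sub>R real_vec a)
      = (\<Sum>a\<in>A. if a \<in> F then c a *\<^sub>R real_vec a else 0)"
    by (intro sum.cong) auto
  then show ?thesis
    using assms by (simp add: sum.inter_restrict[OF finite_A, symmetric] inf.absorb2)
qed

lemma cone_gen_I: "\<forall>a\<in>F. 0 \<le> c a \<Longrightarrow> (\<Sum>a\<in>F. c a *\<^sub>R real_vec a) \<in> cone_gen F"
  unfolding cone_gen_def by blast

lemma convex_cone_gen: "convex (cone_gen F)"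
  unfolding convex_def
proof (intro ballI allI impI)
  fix x y and s t :: real
  assume "x \<in> cone_gen F" "y \<in> cone_gen F" "0 \<le> s" "0 \<le> t"
  then obtain c d where "x = (\<Sum>a\<in>F. c a *\<^sub>R real_vec a)" "y = (\<Sum>a\<in>F. d a *\<^sub>R real_vec a)"
    "\<forall>a\<in>F. 0 \<le> c a" "\<forall>a\<in>F. 0 \<le> d a"
    unfolding cone_gen_def by blast
  then have "s *\<^sub>R x + t *\<^sub>R y = (\<Sum>a\<in>F. (s * c a + t * d a) *\<^sub>R real_vec a)"
      "\<forall>a\<in>F. 0 \<le> s * c a + t * d a"
    using \<open>0 \<le> s\<close> \<open>0 \<le> t\<close> by (simp_all add: scaleR_sum_right scaleR_add_left sum.distrib)
  then show "s *\<^sub>R x + t *\<^sub>R y \<in> cone_gen F"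
    using cone_gen_I[of F "\<lambda>a. s * c a + t * d a"] by simp
qed

lemma real_vec_NN: "x \<in> NN F \<Longrightarrow> t \<ge> 0 \<Longrightarrow> t *\<^sub>R real_vec x \<in> cone_gen F"
proof (erule NN_E)
  fix n assume "x = (\<Sum>a\<in>F. int (n a) *s a)" "t \<ge> 0"
  then have "t *\<^sub>R real_vec x = (\<Sum>a\<in>F. (t * real (n a)) *\<^sub>R real_vec a)" "\<forall>a\<in>F. 0 \<le> t * real (n a)"
    by (simp_all add: real_vec_sum real_vec_scale scaleR_sum_right)
  then show "t *\<^sub>R real_vec x \<in> cone_gen F"
    using cone_gen_I[of F "\<lambda>a. t * real (n a)"] by simp
qed

text \<open>From cones to monoids the defining property is applied to the segment from \<open>2a\<close> to \<open>2x\<close>, whose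
midpoint is \<open>a + x\<close>. Conversely, an equation between a convex combination of two points of the cone
and a point of \<open>cone_gen F\<close> is a real relation that is nonnegative outside \<open>F\<close>, so
\<open>divisor_closed_face_relation\<close> removes all coefficients outside \<open>F\<close>.\<close>

lemma is_face_iff: "is_face A F \<longleftrightarrow> divisor_closed_face F"
proof
  assume F: "is_face A F"
  then have "F \<subseteq> A" and face: "cone_gen F face_of cone_gen A"
    and F': "{a \<in> A. real_vec a \<in> cone_gen F} = F"
    by (auto simp: is_face_def)
  have "a \<in> F" if a: "a \<in> A" and x: "x \<in> Q" and ax: "a + x \<in> NN F" for a x
  proof -
    define u where "u = 2 *\<^sub>R real_vec a"
    define w where "w = 2 *\<^sub>R real_vec x"
    have uw: "(1/2) *\<^sub>R (u + w) \<in> cone_gen F"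
      using real_vec_NN[OF ax, of 1] by (simp add: real_vec_add u_def w_def scaleR_add_right)
    have "u \<in> cone_gen A" "w \<in> cone_gen A"
      unfolding u_def w_def using NN_gen[OF finite_A a] x by (auto intro: real_vec_NN)
    moreover have "(1/2) *\<^sub>R (u + w) \<in> open_segment u w" if "u \<noteq> w"
      using that midpoint_in_open_segment[of u w]
      by (simp add: midpoint_def)
    ultimately have u: "u \<in> cone_gen F"
    proof (cases "u = w")
      case True
      then show ?thesis
        using uw by (simp add: scaleR_add_left[symmetric] scaleR_2[symmetric])
    next
      case False
      with \<open>u \<noteq> w \<Longrightarrow> _\<close> \<open>u \<in> _\<close> \<open>w \<in> _\<close> uw show ?thesis
        using face unfolding face_of_def by blast
    qed
    have "0 \<in> cone_gen F"
      using real_vec_NN[OF zero_NN, of 0] by simp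
    then have "(1/2) *\<^sub>R u + (1/2) *\<^sub>R 0 \<in> cone_gen F"
      by (intro convexD[OF convex_cone_gen] u) auto
    then have "real_vec a \<in> cone_gen F"
      by (simp add: u_def)
    then show ?thesis
      using a F' by blast
  qed
  then show "divisor_closed_face F"
    using \<open>F \<subseteq> A\<close> by (auto simp: divisor_closed_face_def)
next
  assume F: "divisor_closed_face F"
  then have "F \<subseteq> A"
    by (simp add: divisor_closed_face_def)
  have sub: "cone_gen F \<subseteq> cone_gen A"
  proof
    fix x assume "x \<in> cone_gen F"
    then obtain c where c: "x = (\<Sum>a\<in>F. c a *\<^sub>R real_vec a)" "\<forall>a\<in>F. 0 \<le> c a"
      unfolding cone_gen_def by blast
    then have "x = (\<Sum>a\<in>A. (if a \<in> F then c a else 0) *\<^sub>R real_vec a)"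
      using sum_restrict_coefficients[OF \<open>F \<subseteq> A\<close>] by simp
    moreover have "\<forall>a\<in>A. 0 \<le> (if a \<in> F then c a else 0)"
      using c(2) by simp
    ultimately show "x \<in> cone_gen A"
      unfolding cone_gen_def by (intro CollectI exI[where x = "\<lambda>a. if a \<in> F then c a else 0"]) simp
  qed
  have summand: "x \<in> cone_gen F"
    if x: "x \<in> cone_gen A" and y: "y \<in> cone_gen A" and st: "0 < s" "0 \<le> t"
      and z: "s *\<^sub>R x + t *\<^sub>R y \<in> cone_gen F" for x y and s t :: real
  proof -
    obtain c d where c: "x = (\<Sum>a\<in>A. c a *\<^sub>R real_vec a)" "\<forall>a\<in>A. 0 \<le> c a"
      and d: "y = (\<Sum>a\<in>A. d a *\<^sub>R real_vec a)" "\<forall>a\<in>A. 0 \<le> d a"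
      using x y unfolding cone_gen_def by blast
    obtain e where e: "s *\<^sub>R x + t *\<^sub>R y = (\<Sum>a\<in>F. e a *\<^sub>R real_vec a)"
      using z unfolding cone_gen_def by blast
    have rel: "(\<Sum>a\<in>A. (s * c a + t * d a - (if a \<in> F then e a else 0)) *\<^sub>R real_vec a) = 0"
      using e sum_restrict_coefficients[OF \<open>F \<subseteq> A\<close>, of e]
      by (simp add: c d scaleR_sum_right scaleR_add_left scaleR_diff_left sum.distrib sum_subtractf)
    have nn: "0 \<le> s * c a" "0 \<le> t * d a" if "a \<in> A" for a
      using c d st that by auto
    have "c b = 0" if b: "b \<in> A - F" for b
      using divisor_closed_face_relation[OF F rel _ b] nn st that
      by (auto simp: add_nonneg_eq_0_iff)
    then have "x = (\<Sum>a\<in>F. c a *\<^sub>R real_vec a)"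
      unfolding c using \<open>F \<subseteq> A\<close> finite_A by (intro sum.mono_neutral_right) auto
    then show ?thesis
      using c(2) \<open>F \<subseteq> A\<close> unfolding cone_gen_def by blast
  qed
  have "cone_gen F face_of cone_gen A"
    unfolding face_of_def
  proof (intro conjI ballI impI)
    fix x y z assume "x \<in> cone_gen A" "y \<in> cone_gen A" "z \<in> cone_gen F" "z \<in> open_segment x y"
    moreover obtain u where "z = (1 - u) *\<^sub>R x + u *\<^sub>R y" "0 < u" "u < 1"
      using \<open>z \<in> open_segment x y\<close> by (auto simp: in_segment)
    ultimately show "x \<in> cone_gen F" "y \<in> cone_gen F"
      using summand[of x y "1 - u" u] summand[of y x u "1 - u"] by (auto simp: add.commute)
  qed (use sub convex_cone_gen in auto)
  moreover have "a \<in> F" if "a \<in> A" and a: "real_vec a \<in> cone_gen F" for a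
  proof (rule ccontr)
    assume "a \<notin> F"
    obtain e where e: "real_vec a = (\<Sum>b\<in>F. e b *\<^sub>R real_vec b)"
      using a unfolding cone_gen_def by auto
    define v where "v b = (if b = a then 1 else 0) - (if b \<in> F then e b else 0)" for b
    have "(\<Sum>b\<in>A. (if b = a then 1 else 0) *\<^sub>R real_vec b) = real_vec a"
    proof -
      have "(\<Sum>b\<in>A. (if b = a then 1 else 0) *\<^sub>R real_vec b) = (\<Sum>b\<in>A. if b = a then real_vec b else 0)"
        by (intro sum.cong) auto
      then show ?thesis
        using finite_A that by simp
    qed
    then have rel: "(\<Sum>b\<in>A. v b *\<^sub>R real_vec b) = 0"
      using e sum_restrict_coefficients[OF \<open>F \<subseteq> A\<close>, of e]
      by (simp add: v_def scaleR_diff_left sum_subtractf)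
    have "v a = 0"
      by (rule divisor_closed_face_relation[OF F rel]) (use that \<open>a \<notin> F\<close> in \<open>auto simp: v_def\<close>)
    then show False
      using \<open>a \<notin> F\<close> by (simp add: v_def)
  qed
  moreover have "real_vec a \<in> cone_gen F" if "a \<in> F" for a
    using real_vec_NN[of a F 1] NN_gen[of F a] that \<open>F \<subseteq> A\<close> finite_A by (auto intro: finite_subset)
  ultimately show "is_face A F"
    unfolding is_face_def using \<open>F \<subseteq> A\<close> by blast
qed

text \<open>A face of a polyhedral cone is exposed. Here \<open>0\<close> is separated from the sum of the convex hull of
\<open>A - F\<close> and the span of \<open>F\<close>, which avoids \<open>0\<close> by \<open>divisor_closed_face_relation\<close>; a functional that
is bounded below on the span vanishes there.\<close>

lemma face_functional:
  assumes F: "divisor_closed_face F"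
  obtains h where "\<And>a. a \<in> F \<Longrightarrow> h \<bullet> real_vec a = 0" "\<And>a. a \<in> A - F \<Longrightarrow> 0 < h \<bullet> real_vec a"
proof (cases "A - F = {}")
  case True
  then show thesis
    using that[of 0] by auto
next
  case False
  then obtain k where k: "k \<in> A - F"
    by blast
  have "F \<subseteq> A"
    using F by (simp add: divisor_closed_face_def)
  define K where "K = convex hull (real_vec ` (A - F))"
  define L where "L = span (real_vec ` F)"
  let ?S = "\<Union>x\<in>K. \<Union>y\<in>L. {x + y}"
  have inj: "inj_on real_vec X" for X :: "(int ^ 'd) set"
    by (auto simp: inj_on_def)
  have "convex ?S"
    unfolding K_def L_def by (intro convex_sums convex_convex_hull subspace_imp_convex subspace_span)
  moreover have "closed ?S"
    unfolding K_def L_def using finite_A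
    by (intro compact_closed_sums finite_imp_compact_convex_hull closed_span) auto
  moreover have "0 \<notin> ?S"
  proof
    assume "0 \<in> ?S"
    then obtain x y where xy: "x \<in> K" "y \<in> L" "x + y = 0"
      by (auto dest: sym)
    obtain u where u: "x = (\<Sum>a\<in>A - F. u (real_vec a) *\<^sub>R real_vec a)"
      "\<And>a. a \<in> A - F \<Longrightarrow> 0 \<le> u (real_vec a)" "(\<Sum>a\<in>A - F. u (real_vec a)) = 1"
      using xy(1) finite_A unfolding K_def
      by (auto simp: convex_hull_finite sum.reindex[OF inj])
    have "finite F"
      using finite_A \<open>F \<subseteq> A\<close> by (rule finite_subset[rotated])
    then have "L = range (\<lambda>w. \<Sum>z\<in>real_vec ` F. w z *\<^sub>R z)"
      unfolding L_def by (intro span_finite) simp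
    then obtain w where "y = (\<Sum>z\<in>real_vec ` F. w z *\<^sub>R z)"
      using xy(2) by blast
    then have w: "y = (\<Sum>a\<in>F. w (real_vec a) *\<^sub>R real_vec a)"
      by (simp add: sum.reindex[OF inj])
    define v where "v a = (if a \<in> F then w (real_vec a) else u (real_vec a))" for a
    have "(\<Sum>a\<in>A. v a *\<^sub>R real_vec a) = (\<Sum>a\<in>A - F. v a *\<^sub>R real_vec a) + (\<Sum>a\<in>F. v a *\<^sub>R real_vec a)"
      using sum.subset_diff[OF \<open>F \<subseteq> A\<close> finite_A] .
    also have "\<dots> = 0"
      using xy(3) by (simp add: u w v_def)
    finally have rel: "(\<Sum>a\<in>A. v a *\<^sub>R real_vec a) = 0" .
    have "u (real_vec b) = 0" if "b \<in> A - F" for b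
      using divisor_closed_face_relation[OF F rel _ that] that u(2) by (auto simp: v_def)
    then show False
      using u(3) by simp
  qed
  ultimately have "\<exists>h b. h \<noteq> 0 \<and> 0 < b \<and> (\<forall>x\<in>?S. b < h \<bullet> x)"
    by (rule separating_hyperplane_closed_0)
  then obtain h b where h: "0 < b" "\<forall>x\<in>?S. b < h \<bullet> x"
    by auto
  have K: "real_vec a \<in> K" if "a \<in> A - F" for a
    unfolding K_def using that by (intro hull_inc) blast
  have L0: "h \<bullet> y = 0" if "y \<in> L" for y
  proof (rule ccontr)
    assume "h \<bullet> y \<noteq> 0"
    have "(- (h \<bullet> real_vec k) / (h \<bullet> y)) *\<^sub>R y \<in> L"
      using that unfolding L_def by (rule span_scale)
    then have "b < h \<bullet> (real_vec k + (- (h \<bullet> real_vec k) / (h \<bullet> y)) *\<^sub>R y)"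
      using K[OF k] by (intro h(2)[rule_format]) blast
    then show False
      using \<open>h \<bullet> y \<noteq> 0\<close> h(1) by (simp add: inner_diff_right)
  qed
  show thesis
  proof (rule that)
    show "h \<bullet> real_vec a = 0" if "a \<in> F" for a
      using that by (intro L0) (auto simp: L_def intro: span_base)
    show "0 < h \<bullet> real_vec a" if "a \<in> A - F" for a
    proof -
      have "real_vec a + 0 \<in> ?S"
        using K[OF that] span_zero unfolding L_def by blast
      then show ?thesis
        using bspec[OF h(2), of "real_vec a + 0"] h(1) by simp
    qed
  qed
qed

end

section \<open>Finiteness in the monoid\<close>

text \<open>Induction on the index set. Let \<open>Y\<close> serve for the coordinates in \<open>A\<close>. An \<open>x\<close> whose new coordinate
exceeds those of all elements of \<open>Y\<close> is taken care of by \<open>Y\<close>; the remaining \<open>x\<close> fall into finitely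
many slices on which the new coordinate is constant, and each slice has its own finite set.\<close>

lemma dickson:
  fixes X :: "('a \<Rightarrow> nat) set"
  assumes "finite A"
  shows "\<exists>Y \<subseteq> X. finite Y \<and> (\<forall>x\<in>X. \<exists>y\<in>Y. \<forall>a\<in>A. y a \<le> x a)"
  using assms
proof (induction A arbitrary: X)
  case empty
  show ?case
  proof (cases "X = {}")
    case False
    then obtain x where "x \<in> X" by blast
    then show ?thesis by (intro exI[where x = "{x}"]) auto
  qed auto
next
  case (insert a A)
  obtain Y where Y: "Y \<subseteq> X" "finite Y" "\<forall>x\<in>X. \<exists>y\<in>Y. \<forall>b\<in>A. y b \<le> x b"
    using insert.IH[of X] by blast
  define M where "M = (\<Sum>y\<in>Y. y a)"
  have "\<forall>m. \<exists>Z \<subseteq> {x \<in> X. x a = m}. finite Z \<and> (\<forall>x\<in>{x \<in> X. x a = m}. \<exists>y\<in>Z. \<forall>b\<in>A. y b \<le> x b)"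
    using insert.IH by blast
  then have "\<exists>Z. \<forall>m. Z m \<subseteq> {x \<in> X. x a = m} \<and> finite (Z m)
      \<and> (\<forall>x\<in>{x \<in> X. x a = m}. \<exists>y\<in>Z m. \<forall>b\<in>A. y b \<le> x b)"
    by (rule choice)
  then obtain Z where "\<forall>m. Z m \<subseteq> {x \<in> X. x a = m} \<and> finite (Z m)
      \<and> (\<forall>x\<in>{x \<in> X. x a = m}. \<exists>y\<in>Z m. \<forall>b\<in>A. y b \<le> x b)"
    by (elim exE)
  then have Z: "Z m \<subseteq> {x \<in> X. x a = m}" "finite (Z m)"
    "x \<in> X \<Longrightarrow> x a = m \<Longrightarrow> \<exists>y\<in>Z m. \<forall>b\<in>A. y b \<le> x b" for m x
    by auto
  show ?case
  proof (intro exI conjI ballI)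
    show "Y \<union> (\<Union>m<M. Z m) \<subseteq> X"
      using Y(1) Z(1) by blast
    show "finite (Y \<union> (\<Union>m<M. Z m))"
      using Y(2) Z(2) by auto
    fix x assume x: "x \<in> X"
    show "\<exists>y\<in>Y \<union> (\<Union>m<M. Z m). \<forall>b\<in>insert a A. y b \<le> x b"
    proof (cases "x a < M")
      case True
      obtain y where "y \<in> Z (x a)" "\<forall>b\<in>A. y b \<le> x b"
        using Z(3)[OF x refl] by blast
      then show ?thesis
        using Z(1)[of "x a"] True by (intro bexI[where x = y]) auto
    next
      case False
      obtain y where y: "y \<in> Y" "\<forall>b\<in>A. y b \<le> x b"
        using Y(3) x by blast
      have "y a \<le> M"
        unfolding M_def using Y(2) y(1) by (intro member_le_sum) auto
      then show ?thesis
        using y False by (intro bexI[where x = y]) auto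
    qed
  qed
qed

context affine_semigroup
begin

lemma finitely_many_minimal:
  assumes "U \<subseteq> Q"
  obtains V where "V \<subseteq> U" "finite V" "\<And>u. u \<in> U \<Longrightarrow> \<exists>v\<in>V. u - v \<in> Q"
proof -
  define val where "val n = (\<Sum>a\<in>A. int (n a) *s a)" for n :: "int ^ 'd \<Rightarrow> nat"
  obtain Y where Y: "Y \<subseteq> {n. val n \<in> U}" "finite Y"
      "\<And>n. val n \<in> U \<Longrightarrow> \<exists>m\<in>Y. \<forall>a\<in>A. m a \<le> n a"
    using dickson[OF finite_A, of "{n. val n \<in> U}"] by (metis mem_Collect_eq)
  show thesis
  proof (rule that)
    show "val ` Y \<subseteq> U" "finite (val ` Y)"
      using Y by auto
    fix u assume "u \<in> U"
    then obtain n where n: "u = val n"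
      using assms unfolding val_def by (blast elim: NN_E)
    then obtain m where m: "m \<in> Y" "\<forall>a\<in>A. m a \<le> n a"
      using Y(3) \<open>u \<in> U\<close> by blast
    have "(\<Sum>a\<in>A. int (n a - m a) *s a) = (\<Sum>a\<in>A. int (n a) *s a - int (m a) *s a)"
      using m(2) by (intro sum.cong refl) (simp add: of_nat_diff vector_sub_rdistrib)
    then have "u - val m = (\<Sum>a\<in>A. int (n a - m a) *s a)"
      by (simp add: n val_def sum_subtractf)
    then have "u - val m \<in> Q"
      using NN_I[where F = A and n = "\<lambda>a. n a - m a"] by simp
    then show "\<exists>v\<in>val ` Y. u - v \<in> Q"
      using m(1) by blast
  qed
qed

lemma face_subset: "divisor_closed_face F \<Longrightarrow> F \<subseteq> A"
  by (simp add: divisor_closed_face_def)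

lemma face_finite: "divisor_closed_face F \<Longrightarrow> finite F"
  using face_subset finite_A finite_subset by blast

lemma face_NN_Q: "divisor_closed_face F \<Longrightarrow> NN F \<subseteq> Q"
  by (intro NN_mono face_subset finite_A)

lemma face_summand:
  assumes F: "divisor_closed_face F" and "x \<in> Q" "y \<in> Q" "x + y \<in> NN F"
  shows "x \<in> NN F"
proof -
  have "x \<in> Q \<and> (\<forall>y\<in>Q. x + y \<in> NN F \<longrightarrow> x \<in> NN F)"
    using \<open>x \<in> Q\<close>
  proof (rule NN_least)
    fix x x' assume x: "x \<in> Q \<and> (\<forall>y\<in>Q. x + y \<in> NN F \<longrightarrow> x \<in> NN F)"
      and x': "x' \<in> Q \<and> (\<forall>y\<in>Q. x' + y \<in> NN F \<longrightarrow> x' \<in> NN F)"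
    have "x + x' \<in> NN F" if "y \<in> Q" "x + x' + y \<in> NN F" for y
      using x x' NN_add[of x A y] NN_add[of x' A y] NN_add[of x F x'] that
      by (metis add.assoc add.left_commute)
    then show "x + x' \<in> Q \<and> (\<forall>y\<in>Q. x + x' + y \<in> NN F \<longrightarrow> x + x' \<in> NN F)"
      using x x' NN_add by blast
  next
    fix a assume "a \<in> A"
    then show "a \<in> Q \<and> (\<forall>y\<in>Q. a + y \<in> NN F \<longrightarrow> a \<in> NN F)"
      using F NN_gen[OF finite_A] NN_gen[OF face_finite[OF F]]
      unfolding divisor_closed_face_def by blast
  qed auto
  then show ?thesis
    using assms by blast
qed

lemma face_ZZ_Q:
  assumes F: "divisor_closed_face F" and "x \<in> Q" "x \<in> ZZ F"
  shows "x \<in> NN F"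
proof -
  obtain u v where "x = u - v" "u \<in> NN F" "v \<in> NN F"
    using assms(3) unfolding ZZ_eq by blast
  then show ?thesis
    using face_summand[OF F \<open>x \<in> Q\<close>, of v] face_NN_Q[OF F] by auto
qed

lemma face_gen_iff: "divisor_closed_face F \<Longrightarrow> a \<in> A \<Longrightarrow> a \<in> NN F \<longleftrightarrow> a \<in> F"
  using NN_gen[OF face_finite] zero_NN[of A] unfolding divisor_closed_face_def
  by (metis add.right_neutral)

lemma face_NN_subset_iff:
  assumes "divisor_closed_face F" "divisor_closed_face G"
  shows "NN F \<subseteq> NN G \<longleftrightarrow> F \<subseteq> G"
proof
  assume "NN F \<subseteq> NN G"
  then show "F \<subseteq> G"
    using assms face_gen_iff face_subset by blast
qed (intro NN_mono face_finite assms)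

lemma nonface_divisor:
  assumes F: "divisor_closed_face F" and "x \<in> Q" "x \<notin> NN F"
  obtains c where "c \<in> A - F" "x - c \<in> Q"
proof -
  have "x \<in> Q \<and> (x \<in> NN F \<or> (\<exists>c\<in>A - F. x - c \<in> Q))"
    using \<open>x \<in> Q\<close>
  proof (rule NN_least)
    fix x y assume x: "x \<in> Q \<and> (x \<in> NN F \<or> (\<exists>c\<in>A - F. x - c \<in> Q))"
      and y: "y \<in> Q \<and> (y \<in> NN F \<or> (\<exists>c\<in>A - F. y - c \<in> Q))"
    have *: "u - c \<in> Q \<Longrightarrow> v \<in> Q \<Longrightarrow> u + v - c \<in> Q" for u v c
      using NN_add[of "u - c" A v] by (simp add: algebra_simps)
    consider "x \<in> NN F" "y \<in> NN F" | c where "c \<in> A - F" "x - c \<in> Q" | c where "c \<in> A - F" "y - c \<in> Q"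
      using x y by blast
    then have "x + y \<in> NN F \<or> (\<exists>c\<in>A - F. x + y - c \<in> Q)"
    proof cases
      case 1
      then show ?thesis
        using NN_add by blast
    next
      case 2
      then show ?thesis
        using *[of x _ y] y by blast
    next
      case 3
      then show ?thesis
        using *[of y _ x] x by (auto simp: add.commute)
    qed
    then show "x + y \<in> Q \<and> (x + y \<in> NN F \<or> (\<exists>c\<in>A - F. x + y - c \<in> Q))"
      using x y NN_add by blast
  next
    fix a assume "a \<in> A"
    then show "a \<in> Q \<and> (a \<in> NN F \<or> (\<exists>c\<in>A - F. a - c \<in> Q))"
      using NN_gen[OF finite_A] NN_gen[OF face_finite[OF F]] by (cases "a \<in> F") force+
  qed auto
  then have "\<exists>c\<in>A - F. x - c \<in> Q"
    using \<open>x \<notin> NN F\<close> by simp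
  then show thesis
    using that by (elim bexE)
qed

lemma decompose_along_face:
  assumes "F \<subseteq> A" "x \<in> Q"
  obtains n where "x - (\<Sum>c\<in>A - F. int (n c) *s c) \<in> NN F"
proof -
  obtain n where "x = (\<Sum>a\<in>A. int (n a) *s a)"
    using \<open>x \<in> Q\<close> by (rule NN_E)
  then have "x - (\<Sum>c\<in>A - F. int (n c) *s c) = (\<Sum>a\<in>F. int (n a) *s a)"
    using sum.subset_diff[OF \<open>F \<subseteq> A\<close> finite_A, of "\<lambda>a. int (n a) *s a"] by simp
  then show thesis
    using that[of n] NN_I[where F = F and n = n] by simp
qed

lemma face_empty: "divisor_closed_face {}"
  unfolding divisor_closed_face_def
proof (intro conjI ballI impI)
  fix a x assume a: "a \<in> A" and "x \<in> Q" and "a + x \<in> NN {}"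
  then obtain n where n: "x = (\<Sum>b\<in>A. int (n b) *s b)" and ax: "a + x = 0"
    by (auto elim: NN_E)
  define e where "e b = n b + (if b = a then 1 else 0)" for b
  have "a + x = (\<Sum>b\<in>A. (if b = a then b else 0) + int (n b) *s b)"
    using a finite_A by (simp add: n sum.distrib)
  also have "\<dots> = (\<Sum>b\<in>A. int (e b) *s b)"
    unfolding e_def by (intro sum.cong refl) (simp add: vector_sadd_rdistrib)
  finally have "real_vec (\<Sum>b\<in>A. int (e b) *s b) = 0"
    using ax by simp
  then have "(\<Sum>b\<in>A. real (e b) *\<^sub>R real_vec b) = 0"
    by (simp add: real_vec_sum real_vec_scale)
  from nonneg_relation_trivial[OF this _ a] show "a \<in> {}"
    by (simp add: e_def)
qed auto

text \<open>The functional of \<open>face_functional\<close>, as an additive degree on exponents that vanishes exactly on the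
face. For \<open>F = {}\<close> it is positive on all of \<open>A\<close>.\<close>

lemma face_weight:
  assumes F: "divisor_closed_face F"
  obtains w :: "int ^ 'd \<Rightarrow> real" where
    "\<And>x y. w (x + y) = w x + w y" "\<And>n x. w (int n *s x) = real n * w x"
    "\<And>x. x \<in> NN F \<Longrightarrow> w x = 0" "\<And>x. x \<in> Q \<Longrightarrow> 0 \<le> w x" "\<And>c. c \<in> A - F \<Longrightarrow> 0 < w c"
proof -
  obtain h where h: "\<And>a. a \<in> F \<Longrightarrow> h \<bullet> real_vec a = 0" "\<And>a. a \<in> A - F \<Longrightarrow> 0 < h \<bullet> real_vec a"
    using face_functional[OF F] by blast
  define w where "w x = h \<bullet> real_vec x" for x
  have add: "w (x + y) = w x + w y" for x y
    by (simp add: w_def real_vec_add inner_add_right)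
  have 0: "w x = 0" if "x \<in> NN F" for x
    using that by (rule NN_least) (auto simp: add, auto simp: w_def h)
  have nonneg: "0 \<le> w x" if "x \<in> Q" for x
    using that
  proof (rule NN_least)
    show "0 \<le> w a" if "a \<in> A" for a
      using h that by (cases "a \<in> F") (auto simp: w_def less_imp_le)
  qed (auto simp: add, auto simp: w_def)
  show thesis
    by (rule that[of w]) (auto simp: add 0 nonneg, auto simp: w_def real_vec_scale h)
qed

text \<open>A degree that is positive on \<open>A\<close> bounds every coefficient of a divisor of \<open>x\<close>.\<close>

lemma finite_divisors:
  assumes "x \<in> Q"
  shows "finite {y \<in> Q. x - y \<in> Q}"
proof -
  obtain w :: "int ^ 'd \<Rightarrow> real" where w: "\<And>x y. w (x + y) = w x + w y"
    "\<And>n x. w (int n *s x) = real n * w x" "\<And>x. x \<in> Q \<Longrightarrow> 0 \<le> w x" "\<And>c. c \<in> A \<Longrightarrow> 0 < w c"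
    using face_weight[OF face_empty] by (metis Diff_empty)
  have "{y \<in> Q. x - y \<in> Q} \<subseteq> (\<lambda>n. \<Sum>a\<in>A. int (n a) *s a) ` (\<Pi>\<^sub>E a\<in>A. {..nat \<lceil>w x / w a\<rceil>})"
  proof
    fix y assume "y \<in> {y \<in> Q. x - y \<in> Q}"
    then obtain n where n: "y = (\<Sum>a\<in>A. int (n a) *s a)" and "x - y \<in> Q" "y \<in> Q"
      by (auto elim: NN_E)
    have "n a \<le> nat \<lceil>w x / w a\<rceil>" if a: "a \<in> A" for a
    proof -
      have "y = int (n a) *s a + (\<Sum>b\<in>A - {a}. int (n b) *s b)"
        unfolding n using finite_A a by (rule sum.remove)
      moreover have "(\<Sum>b\<in>A - {a}. int (n b) *s b) \<in> Q"
        using NN_scale NN_gen[OF finite_A] by (intro NN_sum) auto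
      moreover have "w x = w y + w (x - y)"
        using w(1)[of y "x - y"] by simp
      ultimately have "real (n a) * w a \<le> w x"
        using w(1,2) w(3)[OF \<open>x - y \<in> Q\<close>] w(3)[of "\<Sum>b\<in>A - {a}. int (n b) *s b"] by simp
      then have "real (n a) \<le> w x / w a"
        using w(4)[OF a] by (simp add: field_simps)
      then show ?thesis
        by linarith
    qed
    then have "restrict n A \<in> (\<Pi>\<^sub>E a\<in>A. {..nat \<lceil>w x / w a\<rceil>})"
      by auto
    moreover have "y = (\<Sum>a\<in>A. int (restrict n A a) *s a)"
      unfolding n by (intro sum.cong) auto
    ultimately show "y \<in> (\<lambda>n. \<Sum>a\<in>A. int (n a) *s a) ` (\<Pi>\<^sub>E a\<in>A. {..nat \<lceil>w x / w a\<rceil>})"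
      by blast
  qed
  then show ?thesis
    by (rule finite_subset) (intro finite_imageI finite_PiE finite_A finite_atMost)
qed

end

section \<open>Laurent polynomials\<close>

lemma keys_mult_cases:
  assumes "z \<in> Poly_Mapping.keys (f * g)"
  obtains x y where "z = x + y" "x \<in> Poly_Mapping.keys f" "y \<in> Poly_Mapping.keys g"
  using assms keys_mult[of f g] by blast

text \<open>The exponents have no built-in total group order, but they embed additively into the linearly
ordered group of finitely supported integer sequences. With respect to the order that they inherit
the leading terms of \<open>f\<close> and \<open>g\<close> multiply to a term of \<open>f * g\<close> that nothing can cancel.\<close>

lemma laurent_eq_zero_of_mult:
  fixes f g :: "int ^ 'd \<Rightarrow>\<^sub>0 'k::field"
  assumes "f * g = 0"
  shows "f = 0 \<or> g = 0"
proof (rule ccontr)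
  assume "\<not> (f = 0 \<or> g = 0)"
  then have ne: "Poly_Mapping.keys f \<noteq> {}" "Poly_Mapping.keys g \<noteq> {}"
    by auto
  obtain e :: "'d \<Rightarrow> nat" where e: "inj e"
    using finite_imp_inj_to_nat_seg[of "UNIV :: 'd set"] by auto
  define h :: "int ^ 'd \<Rightarrow> (nat \<Rightarrow>\<^sub>0 int)" where "h a = (\<Sum>i\<in>UNIV. Poly_Mapping.single (e i) (a $ i))" for a
  have h_add: "h (a + b) = h a + h b" for a b
    by (simp add: h_def single_add sum.distrib)
  have "Poly_Mapping.lookup (h a) (e j) = a $ j" for a j
  proof -
    have "Poly_Mapping.lookup (h a) (e j) = (\<Sum>i\<in>UNIV. if i = j then a $ i else 0)"
      unfolding h_def lookup_sum
      by (intro sum.cong refl) (auto simp: lookup_single when_def inj_eq[OF e])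
    then show ?thesis
      by simp
  qed
  then have h_inj: "h a = h b \<Longrightarrow> a = b" for a b
    by (metis vec_eq_iff)
  \<comment> \<open>Injectivity of \<open>h\<close> makes the leading exponent unique.\<close>
  have max: "\<exists>a\<in>X. \<forall>b\<in>X - {a}. h b < h a" if "finite X" "X \<noteq> {}" for X
  proof -
    have "Max (h ` X) \<in> h ` X"
      using that by (intro Max_in) auto
    then obtain a where "a \<in> X" "h a = Max (h ` X)"
      by (metis imageE)
    then have "h b \<le> h a" if "b \<in> X" for b
      using that \<open>finite X\<close> by simp
    then show ?thesis
      using \<open>a \<in> X\<close> h_inj by (metis DiffE insertCI order_le_less)
  qed
  obtain a where a: "a \<in> Poly_Mapping.keys f" "\<And>x. x \<in> Poly_Mapping.keys f - {a} \<Longrightarrow> h x < h a"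
    using max[OF _ ne(1)] by auto
  obtain b where b: "b \<in> Poly_Mapping.keys g" "\<And>x. x \<in> Poly_Mapping.keys g - {b} \<Longrightarrow> h x < h b"
    using max[OF _ ne(2)] by auto
  define f' where "f' = f - Poly_Mapping.single a (Poly_Mapping.lookup f a)"
  define g' where "g' = g - Poly_Mapping.single b (Poly_Mapping.lookup g b)"
  have keys_f': "Poly_Mapping.keys f' \<subseteq> Poly_Mapping.keys f - {a}"
    by (auto simp: f'_def in_keys_iff lookup_minus lookup_single when_def split: if_splits)
  have keys_g': "Poly_Mapping.keys g' \<subseteq> Poly_Mapping.keys g - {b}"
    by (auto simp: g'_def in_keys_iff lookup_minus lookup_single when_def split: if_splits)
  have hf: "h x \<le> h a" if "x \<in> Poly_Mapping.keys f" for x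
    using a(2)[of x] that by (cases "x = a") (auto simp: less_imp_le)
  have 1: "a + b \<notin> Poly_Mapping.keys (f' * Poly_Mapping.single b (Poly_Mapping.lookup g b))"
  proof
    assume "a + b \<in> Poly_Mapping.keys (f' * Poly_Mapping.single b (Poly_Mapping.lookup g b))"
    then show False
      by (rule keys_mult_cases) (use keys_f' in \<open>auto split: if_splits\<close>)
  qed
  have 2: "a + b \<notin> Poly_Mapping.keys (f * g')"
  proof
    assume "a + b \<in> Poly_Mapping.keys (f * g')"
    then obtain x y where xy: "a + b = x + y" "x \<in> Poly_Mapping.keys f" "y \<in> Poly_Mapping.keys g'"
      by (rule keys_mult_cases)
    then have "h x + h y < h a + h b"
      using hf[of x] b(2)[of y] keys_g' by (intro add_le_less_mono) auto
    then show False
      using xy(1) h_add by (metis less_irrefl)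
  qed
  have "f * g = Poly_Mapping.single a (Poly_Mapping.lookup f a) * Poly_Mapping.single b (Poly_Mapping.lookup g b)
      + f' * Poly_Mapping.single b (Poly_Mapping.lookup g b) + f * g'"
    by (simp add: f'_def g'_def algebra_simps)
  then have "Poly_Mapping.lookup (f * g) (a + b) = Poly_Mapping.lookup f a * Poly_Mapping.lookup g b"
    using 1 2 by (simp add: lookup_add mult_single in_keys_iff)
  then show False
    using assms a(1) b(1) by (auto simp: in_keys_iff)
qed

definition terms_in :: "'a set \<Rightarrow> ('a \<Rightarrow>\<^sub>0 'k::comm_monoid_add) \<Rightarrow> ('a \<Rightarrow>\<^sub>0 'k)" where
  "terms_in X p = (\<Sum>x\<in>Poly_Mapping.keys p \<inter> X. Poly_Mapping.single x (Poly_Mapping.lookup p x))"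

lemma lookup_terms_in: "Poly_Mapping.lookup (terms_in X p) x = (if x \<in> X then Poly_Mapping.lookup p x else 0)"
proof -
  have "Poly_Mapping.lookup (terms_in X p) x = (\<Sum>y\<in>Poly_Mapping.keys p \<inter> X. if y = x then Poly_Mapping.lookup p y else 0)"
    unfolding terms_in_def lookup_sum by (intro sum.cong refl) (auto simp: lookup_single when_def)
  then show ?thesis
    by (auto simp: in_keys_iff)
qed

lemma keys_terms_in: "Poly_Mapping.keys (terms_in X p) = Poly_Mapping.keys p \<inter> X"
  by (auto simp: in_keys_iff lookup_terms_in split: if_splits)

lemma terms_in_eq_self: "Poly_Mapping.keys p \<subseteq> X \<Longrightarrow> terms_in X p = p"
  by (rule poly_mapping_eqI) (auto simp: lookup_terms_in in_keys_iff)

section \<open>Spans of monomials and monomial ideals\<close>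

definition monomial_span :: "(int ^ 'd) set \<Rightarrow> (int ^ 'd \<Rightarrow>\<^sub>0 'k::field) set" where
  "monomial_span X = {p. Poly_Mapping.keys p \<subseteq> X}"

lemma monomial_span_0 [simp]: "0 \<in> monomial_span X"
  by (simp add: monomial_span_def)

lemma monomial_span_add: "p \<in> monomial_span X \<Longrightarrow> q \<in> monomial_span X \<Longrightarrow> p + q \<in> monomial_span X"
  unfolding monomial_span_def using keys_add[of p q] by blast

lemma monomial_span_uminus: "p \<in> monomial_span X \<Longrightarrow> - p \<in> monomial_span X"
  by (simp add: monomial_span_def)

lemma monomial_span_diff: "p \<in> monomial_span X \<Longrightarrow> q \<in> monomial_span X \<Longrightarrow> p - q \<in> monomial_span X"
  unfolding monomial_span_def using keys_diff[of p q] by blast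

lemma monomial_span_mult:
  assumes "p \<in> monomial_span X" "q \<in> monomial_span Y" "\<And>x y. x \<in> X \<Longrightarrow> y \<in> Y \<Longrightarrow> x + y \<in> Z"
  shows "p * q \<in> monomial_span Z"
  using assms keys_mult[of p q] unfolding monomial_span_def by blast

lemma monomial_span_disjoint: "p \<in> monomial_span X \<Longrightarrow> p \<in> monomial_span Y \<Longrightarrow> X \<inter> Y = {} \<Longrightarrow> p = 0"
  unfolding monomial_span_def keys_eq_empty[symmetric] by blast

lemma terms_in_monomial_span: "p \<in> monomial_span Y \<Longrightarrow> terms_in X p \<in> monomial_span (Y \<inter> X)"
  by (auto simp: monomial_span_def keys_terms_in)

lemma minus_terms_in_monomial_span: "p \<in> monomial_span Y \<Longrightarrow> p - terms_in X p \<in> monomial_span (Y - X)"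
  by (auto simp: monomial_span_def in_keys_iff lookup_minus lookup_terms_in split: if_splits)

lemma mon_in_monomial_span [simp]: "(mon a :: int ^ 'd \<Rightarrow>\<^sub>0 'k::field) \<in> monomial_span X \<longleftrightarrow> a \<in> X"
  by (simp add: mon_def monomial_span_def)

lemma monomial_span_mono: "X \<subseteq> Y \<Longrightarrow> monomial_span X \<subseteq> monomial_span Y"
  by (auto simp: monomial_span_def)

lemma monomial_span_induct:
  assumes "p \<in> monomial_span X" "P 0" "\<And>p q. P p \<Longrightarrow> P q \<Longrightarrow> P (p + q)"
    "\<And>x c. x \<in> X \<Longrightarrow> P (Poly_Mapping.single x c)"
  shows "P p"
proof -
  have "P (\<Sum>x\<in>Y. Poly_Mapping.single x (Poly_Mapping.lookup p x))" if "Y \<subseteq> X" for Y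
    using that by (induction Y rule: infinite_finite_induct) (auto simp: assms)
  moreover have "(\<Sum>x\<in>Poly_Mapping.keys p. Poly_Mapping.single x (Poly_Mapping.lookup p x)) = p"
    using terms_in_eq_self[of p UNIV] by (simp add: terms_in_def)
  moreover have "Poly_Mapping.keys p \<subseteq> X"
    using assms(1) by (simp add: monomial_span_def)
  ultimately show ?thesis
    by metis
qed

lemma semigroup_ring_simps [simp]:
  "carrier (semigroup_ring A) = monomial_span (NN A)"
  "mult (semigroup_ring A) = (*)" "one (semigroup_ring A) = 1"
  "zero (semigroup_ring A) = 0" "add (semigroup_ring A) = (+)"
  by (simp_all add: semigroup_ring_def monomial_span_def)

lemma one_in_monomial_span [simp]: "(1 :: int ^ 'd \<Rightarrow>\<^sub>0 'k::field) \<in> monomial_span X \<longleftrightarrow> 0 \<in> X"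
  by (simp add: monomial_span_def)

lemma semigroup_ring_pow: "x [^]\<^bsub>semigroup_ring A\<^esub> (n::nat) = x ^ n"
  by (induction n) (simp_all add: nat_pow_def mult.commute)

lemma semigroup_ring_mult:
  "p \<in> monomial_span (NN A) \<Longrightarrow> q \<in> monomial_span (NN A) \<Longrightarrow> p * q \<in> monomial_span (NN A)"
  by (rule monomial_span_mult) (auto intro: NN_add)

lemma semigroup_ring_cring: "cring (semigroup_ring A :: (int ^ 'd \<Rightarrow>\<^sub>0 'k::field) ring)"
proof (rule cringI)
  show "abelian_group (semigroup_ring A :: (int ^ 'd \<Rightarrow>\<^sub>0 'k) ring)"
  proof (rule abelian_groupI)
    fix x :: "int ^ 'd \<Rightarrow>\<^sub>0 'k" assume "x \<in> carrier (semigroup_ring A)"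
    then show "\<exists>y\<in>carrier (semigroup_ring A). y \<oplus>\<^bsub>semigroup_ring A\<^esub> x = \<zero>\<^bsub>semigroup_ring A\<^esub>"
      by (intro bexI[where x = "- x"]) (auto simp: monomial_span_uminus)
  qed (auto simp: monomial_span_add algebra_simps)
  show "Group.comm_monoid (semigroup_ring A :: (int ^ 'd \<Rightarrow>\<^sub>0 'k) ring)"
    by (rule comm_monoidI) (auto simp: semigroup_ring_mult algebra_simps)
qed (auto simp: algebra_simps)

lemma semigroup_ring_idealI:
  fixes J :: "(int ^ 'd \<Rightarrow>\<^sub>0 'k::field) set"
  assumes "J \<subseteq> monomial_span (NN A)" "0 \<in> J" "\<And>x y. x \<in> J \<Longrightarrow> y \<in> J \<Longrightarrow> x + y \<in> J"
    "\<And>x r. x \<in> J \<Longrightarrow> r \<in> monomial_span (NN A) \<Longrightarrow> r * x \<in> J"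
  shows "ideal J (semigroup_ring A)"
proof -
  interpret cring "semigroup_ring A :: (int ^ 'd \<Rightarrow>\<^sub>0 'k) ring"
    by (rule semigroup_ring_cring)
  have neg: "\<ominus>\<^bsub>semigroup_ring A\<^esub> x = - x" if "x \<in> monomial_span (NN A)" for x :: "int ^ 'd \<Rightarrow>\<^sub>0 'k"
    using that minus_equality[of "- x" x] by (simp add: monomial_span_uminus)
  have "- x \<in> J" if "x \<in> J" for x
    using assms(4)[OF that, of "- 1"] by (simp add: monomial_span_uminus)
  then show ?thesis
    using assms neg[unfolded a_inv_def, simplified]
    by (intro idealI ring_axioms group.subgroupI[OF add.is_group])
      (auto simp: mult.commute subset_iff)
qed

lemma semigroup_ring_idealD:
  assumes "ideal J (semigroup_ring A :: (int ^ 'd \<Rightarrow>\<^sub>0 'k::field) ring)"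
  shows "J \<subseteq> monomial_span (NN A)" "0 \<in> J" "x \<in> J \<Longrightarrow> y \<in> J \<Longrightarrow> x + y \<in> J"
    "x \<in> J \<Longrightarrow> r \<in> monomial_span (NN A) \<Longrightarrow> r * x \<in> J"
proof -
  interpret ideal J "semigroup_ring A :: (int ^ 'd \<Rightarrow>\<^sub>0 'k) ring"
    by fact
  show "J \<subseteq> monomial_span (NN A)"
    using a_subset by simp
  show "0 \<in> J"
    using additive_subgroup.zero_closed[OF is_additive_subgroup] by simp
  show "x + y \<in> J" if "x \<in> J" "y \<in> J"
    using additive_subgroup.a_closed[OF is_additive_subgroup that] by simp
  show "r * x \<in> J" if "x \<in> J" "r \<in> monomial_span (NN A)"
    using I_l_closed[OF that(1), of r] that(2) by simp
qed

text \<open>These are exactly the exponent sets of the monomial ideals, see \<open>monomial_ideal_iff\<close>.\<close>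

definition absorbing :: "(int ^ 'd) set \<Rightarrow> (int ^ 'd) set \<Rightarrow> bool" where
  "absorbing A X \<longleftrightarrow> X \<subseteq> NN A \<and> (\<forall>x\<in>X. \<forall>y\<in>NN A. x + y \<in> X)"

lemma ideal_monomial_span:
  assumes "absorbing A X"
  shows "ideal (monomial_span X) (semigroup_ring A :: (int ^ 'd \<Rightarrow>\<^sub>0 'k::field) ring)"
proof (rule semigroup_ring_idealI)
  show "r * x \<in> monomial_span X" if "x \<in> monomial_span X" "r \<in> monomial_span (NN A)"
    for r x :: "int ^ 'd \<Rightarrow>\<^sub>0 'k"
  proof (rule monomial_span_mult[OF that(2,1)])
    fix y z assume "y \<in> NN A" "z \<in> X"
    then show "y + z \<in> X"
      using assms unfolding absorbing_def by (metis add.commute)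
  qed
qed (use assms in \<open>auto simp: absorbing_def monomial_span_add intro: subsetD[OF monomial_span_mono]\<close>)

lemma genideal_monomials:
  assumes "B \<subseteq> NN A"
  shows "Idl\<^bsub>semigroup_ring A\<^esub> ((mon :: _ \<Rightarrow> int ^ 'd \<Rightarrow>\<^sub>0 'k::field) ` B)
    = monomial_span {b + x | b x. b \<in> B \<and> x \<in> NN A}" (is "?I = monomial_span ?X")
proof
  interpret cring "semigroup_ring A :: (int ^ 'd \<Rightarrow>\<^sub>0 'k) ring"
    by (rule semigroup_ring_cring)
  have sub: "(mon :: _ \<Rightarrow> int ^ 'd \<Rightarrow>\<^sub>0 'k) ` B \<subseteq> carrier (semigroup_ring A)"
    using assms by auto
  have "absorbing A ?X"
    unfolding absorbing_def using assms by (fastforce intro: NN_add simp: add.assoc)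
  moreover have "(mon :: _ \<Rightarrow> int ^ 'd \<Rightarrow>\<^sub>0 'k) ` B \<subseteq> monomial_span ?X"
    by (force intro: exI[where x = 0])
  ultimately show "?I \<subseteq> monomial_span ?X"
    by (intro genideal_minimal ideal_monomial_span)
  note I = semigroup_ring_idealD[OF genideal_ideal[OF sub]]
  show "monomial_span ?X \<subseteq> ?I"
  proof
    fix p :: "int ^ 'd \<Rightarrow>\<^sub>0 'k" assume "p \<in> monomial_span ?X"
    then show "p \<in> ?I"
    proof (rule monomial_span_induct)
      fix z and c :: 'k assume "z \<in> ?X"
      then obtain b x where bx: "z = b + x" "b \<in> B" "x \<in> NN A"
        by blast
      have "Poly_Mapping.single x c * mon b \<in> ?I"
        using bx genideal_self[OF sub] by (intro I(4)) (auto simp: monomial_span_def)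
      then show "Poly_Mapping.single z c \<in> ?I"
        by (simp add: mon_def mult_single bx(1) add.commute)
    qed (use I in auto)
  qed
qed

lemma monomial_ideal_iff:
  "monomial_ideal A (I :: (int ^ 'd \<Rightarrow>\<^sub>0 'k::field) set) \<longleftrightarrow> (\<exists>X. absorbing A X \<and> I = monomial_span X)"
proof
  assume "monomial_ideal A I"
  then obtain B where B: "B \<subseteq> NN A" "I = Idl\<^bsub>semigroup_ring A\<^esub> (mon ` B)"
    unfolding monomial_ideal_def by blast
  have "absorbing A {b + x | b x. b \<in> B \<and> x \<in> NN A}"
    unfolding absorbing_def using B(1) by (fastforce intro: NN_add simp: add.assoc)
  then show "\<exists>X. absorbing A X \<and> I = monomial_span X"
    using genideal_monomials[OF B(1)] B(2) by blast
next
  assume "\<exists>X. absorbing A X \<and> I = monomial_span X"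
  then obtain X where X: "absorbing A X" "I = monomial_span X"
    by blast
  have "{b + x | b x. b \<in> X \<and> x \<in> NN A} = X"
    using X(1) zero_NN[of A] unfolding absorbing_def by (force intro: exI[where x = 0])
  then show "monomial_ideal A I"
    using genideal_monomials[of X A] X unfolding monomial_ideal_def absorbing_def by metis
qed

lemma std_monomial_span: "std A (monomial_span X :: (int ^ 'd \<Rightarrow>\<^sub>0 'k::field) set) = NN A - X"
  by (auto simp: std_def)

lemma monomial_ideal_eq:
  assumes "monomial_ideal A (I :: (int ^ 'd \<Rightarrow>\<^sub>0 'k::field) set)"
  shows "absorbing A (NN A - std A I)" "I = monomial_span (NN A - std A I)"
proof -
  obtain X where X: "absorbing A X" "I = monomial_span X"
    using assms monomial_ideal_iff by blast
  then have "NN A - std A I = X"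
    by (auto simp: std_monomial_span absorbing_def)
  then show "absorbing A (NN A - std A I)" "I = monomial_span (NN A - std A I)"
    using X by auto
qed

section \<open>Primary monomial ideals\<close>

lemma of_nat_in_span: "(of_nat n :: int ^ 'd \<Rightarrow>\<^sub>0 'k::field) \<in> monomial_span (NN A)"
  by (induction n) (auto simp: monomial_span_add)

lemma power_in_span: "p \<in> monomial_span (NN A) \<Longrightarrow> p ^ n \<in> monomial_span (NN A)"
  by (induction n) (auto simp: semigroup_ring_mult)

text \<open>Every term of the binomial expansion is divisible by \<open>x ^ m\<close> or by \<open>y ^ n\<close>.\<close>

lemma power_add_in_ideal:
  fixes x y :: "int ^ 'd \<Rightarrow>\<^sub>0 'k::field"
  assumes J: "ideal J (semigroup_ring A)" and xy: "x \<in> monomial_span (NN A)" "y \<in> monomial_span (NN A)"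
    and m: "x ^ m \<in> J" and n: "y ^ n \<in> J"
  shows "(x + y) ^ (m + n) \<in> J"
proof -
  note J = semigroup_ring_idealD[OF J]
  have "of_nat ((m + n) choose k) * x ^ k * y ^ (m + n - k) \<in> J" for k
  proof (cases "m \<le> k")
    case True
    have "of_nat ((m + n) choose k) * x ^ (k - m) * y ^ (m + n - k) * x ^ m \<in> J"
      by (intro J(4)[OF m] semigroup_ring_mult of_nat_in_span power_in_span xy)
    moreover have e: "x ^ k = x ^ (k - m) * x ^ m"
      using True by (simp add: power_add[symmetric])
    ultimately show ?thesis
      unfolding e by (simp only: mult_ac)
  next
    case False
    have "of_nat ((m + n) choose k) * x ^ k * y ^ (m - k) * y ^ n \<in> J"
      by (intro J(4)[OF n] semigroup_ring_mult of_nat_in_span power_in_span xy)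
    moreover have e: "y ^ (m + n - k) = y ^ (m - k) * y ^ n"
      using False by (simp add: power_add[symmetric])
    ultimately show ?thesis
      unfolding e by (simp only: mult_ac)
  qed
  moreover have "sum f K \<in> J" if "\<And>k. f k \<in> J" for f and K :: "nat set"
    using that by (induction K rule: infinite_finite_induct) (auto simp: J)
  ultimately show ?thesis
    unfolding binomial_ring by simp
qed

lemma single_power: "Poly_Mapping.single (x :: int ^ 'd) (c :: 'k::field) ^ n = Poly_Mapping.single (int n *s x) (c ^ n)"
  by (induction n) (simp_all add: mult_single vector_sadd_rdistrib)

context affine_semigroup
begin

lemma absorbing_nonface:
  assumes "divisor_closed_face F"
  shows "absorbing A (Q - NN F)"
  unfolding absorbing_def using face_summand[OF assms] NN_add[of _ A] by blast

lemma face_prime_eq: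
  assumes "divisor_closed_face F"
  shows "(face_prime A F :: (int ^ 'd \<Rightarrow>\<^sub>0 'k::field) set) = monomial_span (Q - NN F)"
proof -
  have "{b + x | b x. b \<in> Q - NN F \<and> x \<in> Q} = Q - NN F"
    using absorbing_nonface[OF assms] zero_NN[of A] unfolding absorbing_def
    by (force intro: exI[where x = 0])
  then show ?thesis
    unfolding face_prime_def by (subst genideal_monomials) auto
qed

text \<open>Modulo the span of \<open>Q - NN F\<close> an element is represented by its terms with exponents in \<open>NN F\<close>, and
these multiply without zero divisors.\<close>

lemma nonface_span_prime:
  fixes p q :: "int ^ 'd \<Rightarrow>\<^sub>0 'k::field"
  assumes F: "divisor_closed_face F" and pq: "p \<in> monomial_span Q" "q \<in> monomial_span Q"
    and "p * q \<in> monomial_span (Q - NN F)"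
  shows "p \<in> monomial_span (Q - NN F) \<or> q \<in> monomial_span (Q - NN F)"
proof -
  note P = semigroup_ring_idealD[OF ideal_monomial_span[OF absorbing_nonface[OF F]]]
  define p0 where "p0 = terms_in (NN F) p"
  define q0 where "q0 = terms_in (NN F) q"
  have p0: "p0 \<in> monomial_span (NN F)" "p - p0 \<in> monomial_span (Q - NN F)"
    and q0: "q0 \<in> monomial_span (NN F)" "q - q0 \<in> monomial_span (Q - NN F)"
    using terms_in_monomial_span[of p Q "NN F"] terms_in_monomial_span[of q Q "NN F"] pq
      minus_terms_in_monomial_span monomial_span_mono[of "Q \<inter> NN F" "NN F"]
    unfolding p0_def q0_def by blast+
  have p0Q: "p0 \<in> monomial_span Q"
    using p0(1) monomial_span_mono[OF face_NN_Q[OF F]] by blast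
  have "p0 * q0 = p * q - (q * (p - p0) + p0 * (q - q0))"
    by (simp add: algebra_simps)
  then have "p0 * q0 \<in> monomial_span (Q - NN F)"
    using assms(4) P(3)[OF P(4)[OF p0(2) pq(2)] P(4)[OF q0(2) p0Q]]
    by (simp add: monomial_span_diff)
  moreover have "p0 * q0 \<in> monomial_span (NN F)"
    using p0(1) q0(1) by (rule monomial_span_mult) (rule NN_add)
  ultimately have "p0 * q0 = 0"
    by (rule monomial_span_disjoint) blast
  then have "p0 = 0 \<or> q0 = 0"
    by (rule laurent_eq_zero_of_mult)
  then show ?thesis
    using p0(2) q0(2) by auto
qed

lemma face_prime_primeideal:
  assumes F: "divisor_closed_face F"
  shows "primeideal (face_prime A F) (semigroup_ring A :: (int ^ 'd \<Rightarrow>\<^sub>0 'k::field) ring)"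
  unfolding face_prime_eq[OF F]
proof (rule primeidealI)
  have "(1 :: int ^ 'd \<Rightarrow>\<^sub>0 'k) \<in> monomial_span Q" "(1 :: int ^ 'd \<Rightarrow>\<^sub>0 'k) \<notin> monomial_span (Q - NN F)"
    by simp_all
  then show "carrier (semigroup_ring A :: (int ^ 'd \<Rightarrow>\<^sub>0 'k) ring) \<noteq> monomial_span (Q - NN F)"
    unfolding semigroup_ring_simps by blast
qed (use nonface_span_prime[OF F] in \<open>auto simp: ideal_monomial_span absorbing_nonface F semigroup_ring_cring\<close>)

lemma colon_ideal:
  fixes x :: "int ^ 'd \<Rightarrow>\<^sub>0 'k::field"
  assumes "ideal J (semigroup_ring A)" "x \<in> monomial_span Q"
  shows "ideal {g \<in> monomial_span Q. g * x \<in> J} (semigroup_ring A)"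
proof (rule semigroup_ring_idealI)
  note J = semigroup_ring_idealD[OF assms(1)]
  fix g h assume g: "g \<in> {g \<in> monomial_span Q. g * x \<in> J}"
  show "g + h \<in> {g \<in> monomial_span Q. g * x \<in> J}" if "h \<in> {g \<in> monomial_span Q. g * x \<in> J}"
    using g that J by (auto simp: distrib_right monomial_span_add)
  show "h * g \<in> {g \<in> monomial_span Q. g * x \<in> J}" if "h \<in> monomial_span Q"
    using g that J by (auto simp: mult.assoc semigroup_ring_mult)
qed (use semigroup_ring_idealD[OF assms(1)] in auto)

text \<open>It suffices that each monomial is nilpotent modulo \<open>X\<close>, because the elements nilpotent modulo an
ideal are closed under addition.\<close>

lemma nilpotent_nonface_span:
  fixes y :: "int ^ 'd \<Rightarrow>\<^sub>0 'k::field"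
  assumes F: "divisor_closed_face F" and X: "absorbing A X"
    and nil: "\<And>c. c \<in> Q - NN F \<Longrightarrow> \<exists>n>0. int n *s c \<in> X"
    and "y \<in> monomial_span (Q - NN F)"
  shows "\<exists>n>0. y ^ n \<in> monomial_span X"
proof -
  have I: "ideal (monomial_span X :: (int ^ 'd \<Rightarrow>\<^sub>0 'k) set) (semigroup_ring A)"
    by (rule ideal_monomial_span[OF X])
  have "y \<in> monomial_span Q \<and> (\<exists>n>0. y ^ n \<in> monomial_span X)"
    using assms(4)
  proof (rule monomial_span_induct)
    show "0 \<in> monomial_span Q \<and> (\<exists>n>0. (0 :: int ^ 'd \<Rightarrow>\<^sub>0 'k) ^ n \<in> monomial_span X)"
      by (auto intro!: exI[where x = 1])
  next
    fix p q :: "int ^ 'd \<Rightarrow>\<^sub>0 'k"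
    assume "p \<in> monomial_span Q \<and> (\<exists>n>0. p ^ n \<in> monomial_span X)"
      and "q \<in> monomial_span Q \<and> (\<exists>n>0. q ^ n \<in> monomial_span X)"
    then obtain m n where "m > 0" "p ^ m \<in> monomial_span X" "n > 0" "q ^ n \<in> monomial_span X"
      and pq: "p \<in> monomial_span Q" "q \<in> monomial_span Q"
      by blast
    then have "(p + q) ^ (m + n) \<in> monomial_span X" "m + n > 0"
      using power_add_in_ideal[OF I] by auto
    then show "p + q \<in> monomial_span Q \<and> (\<exists>n>0. (p + q) ^ n \<in> monomial_span X)"
      using pq monomial_span_add by blast
  next
    fix c and r :: 'k assume "c \<in> Q - NN F"
    moreover from this obtain n where "n > 0" "int n *s c \<in> X"
      using nil by blast
    ultimately show "Poly_Mapping.single c r \<in> monomial_span Q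
        \<and> (\<exists>n>0. Poly_Mapping.single c r ^ n \<in> monomial_span X)"
      by (auto simp: single_power monomial_span_def intro!: exI[where x = n])
  qed
  then show ?thesis
    by blast
qed

text \<open>Suppose \<open>x * y\<close> is in \<open>J\<close> and \<open>y\<close> is not in the face prime, that is, the part \<open>y0\<close> of \<open>y\<close> supported
on \<open>NN F\<close> is nonzero. Since \<open>y0 - y\<close> is nilpotent modulo \<open>J\<close>, some power \<open>z\<close> of \<open>y0\<close> satisfies
\<open>z * x \<in> J\<close>. But by \<open>stable\<close> multiplication with an element supported on \<open>NN F\<close> keeps exponents outside
\<open>X\<close> outside \<open>X\<close>, so the terms of \<open>x\<close> outside \<open>X\<close> are annihilated by \<open>z \<noteq> 0\<close> and hence vanish.\<close>

lemma monomial_primary: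
  fixes J :: "(int ^ 'd \<Rightarrow>\<^sub>0 'k::field) set"
  assumes F: "divisor_closed_face F" and X: "absorbing A X" and "0 \<notin> X"
    and stable: "\<And>s f. s \<in> Q - X \<Longrightarrow> f \<in> NN F \<Longrightarrow> s + f \<notin> X"
    and nil: "\<And>c. c \<in> Q - NN F \<Longrightarrow> \<exists>n>0. int n *s c \<in> X"
    and J: "J = monomial_span X"
  shows "primary_to (face_prime A F) J (semigroup_ring A)"
proof -
  let ?P = "monomial_span (Q - NN F) :: (int ^ 'd \<Rightarrow>\<^sub>0 'k) set"
  have I: "ideal J (semigroup_ring A)"
    unfolding J by (rule ideal_monomial_span[OF X])
  have "X \<subseteq> Q - NN F"
    using X stable[of 0] \<open>0 \<notin> X\<close> by (auto simp: absorbing_def)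
  then have JP: "J \<subseteq> ?P"
    unfolding J by (rule monomial_span_mono)
  have nilP: "\<exists>n>0. y ^ n \<in> J" if "y \<in> ?P" for y
    unfolding J by (rule nilpotent_nonface_span[OF F X nil that])
  have rad: "radical_ideal (semigroup_ring A) J = ?P"
  proof
    show "?P \<subseteq> radical_ideal (semigroup_ring A) J"
      using nilP monomial_span_mono[of "Q - NN F" Q]
      by (auto simp: radical_ideal_def semigroup_ring_pow)
    have "y \<in> ?P" if "y ^ n \<in> ?P" "y \<in> monomial_span Q" for y n
      using that(1)
    proof (induction n)
      case (Suc n)
      then show ?case
        using nonface_span_prime[OF F that(2) power_in_span[OF that(2)], of n] by auto
    qed simp
    then show "radical_ideal (semigroup_ring A) J \<subseteq> ?P"
      using JP by (auto simp: radical_ideal_def semigroup_ring_pow)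
  qed
  have "x \<in> J" if xQ: "x \<in> monomial_span Q" and yQ: "y \<in> monomial_span Q"
    and xy: "x * y \<in> J" and yP: "y \<notin> ?P" for x y
  proof -
    define y0 where "y0 = terms_in (NN F) y"
    have y0: "y0 \<in> monomial_span (NN F)" "y0 - y \<in> ?P"
      using terms_in_monomial_span[OF yQ, of "NN F"] monomial_span_mono[of "Q \<inter> NN F" "NN F"]
        minus_terms_in_monomial_span[OF yQ, THEN monomial_span_uminus, of "NN F"]
      unfolding y0_def by auto
    have "y0 \<noteq> 0"
      using y0(2) yP monomial_span_uminus[of "y0 - y" "Q - NN F"] by auto
    let ?C = "{g \<in> monomial_span Q. g * x \<in> J}"
    note CI = colon_ideal[OF I xQ]
    have sub: "?P \<subseteq> monomial_span Q"
      by (rule monomial_span_mono) blast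
    obtain n where "(y0 - y) ^ n \<in> J"
      using nilP[OF y0(2)] by blast
    \<comment> \<open>Both \<open>y\<close> and \<open>y0 - y\<close> are nilpotent modulo the colon ideal \<open>?C\<close> of \<open>J\<close> and \<open>x\<close>, hence so is \<open>y0\<close>.\<close>
    then have "(y0 - y) ^ n \<in> ?C"
      using semigroup_ring_idealD(1)[OF I] semigroup_ring_idealD(4)[OF I _ xQ]
      by (auto simp: mult.commute[of _ x])
    moreover have "y ^ 1 \<in> ?C"
      using xy yQ by (simp add: mult.commute)
    ultimately have "(y + (y0 - y)) ^ (1 + n) \<in> ?C"
      using y0(2) sub by (intro power_add_in_ideal[OF CI yQ]) auto
    then have y0x: "y0 ^ (1 + n) * x \<in> J"
      by simp
    define z where "z = y0 ^ (1 + n)"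
    have z: "z \<in> monomial_span (NN F)"
      unfolding z_def using y0(1) by (rule power_in_span)
    have "z \<noteq> 0"
    proof -
      have "y0 ^ k \<noteq> 0" for k
        by (induction k) (use \<open>y0 \<noteq> 0\<close> laurent_eq_zero_of_mult in auto)
      then show ?thesis
        unfolding z_def by blast
    qed
    define x1 where "x1 = terms_in X x"
    have x1: "x1 \<in> J" "x - x1 \<in> monomial_span (Q - X)"
      using terms_in_monomial_span[OF xQ, of X] monomial_span_mono[of "Q \<inter> X" X]
        minus_terms_in_monomial_span[OF xQ, of X] unfolding x1_def J by auto
    have "z * x1 \<in> J"
      using z monomial_span_mono[OF face_NN_Q[OF F]] by (intro semigroup_ring_idealD(4)[OF I] x1) auto
    then have "z * x - z * x1 \<in> monomial_span X"
      using y0x monomial_span_diff unfolding J z_def[symmetric] by blast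
    then have "(x - x1) * z \<in> monomial_span X"
      by (simp add: algebra_simps)
    moreover have "(x - x1) * z \<in> monomial_span (- X)"
      using x1(2) z by (rule monomial_span_mult) (use stable in auto)
    ultimately have "(x - x1) * z = 0"
      by (rule monomial_span_disjoint) blast
    then have "x - x1 = 0"
      using \<open>z \<noteq> 0\<close> laurent_eq_zero_of_mult[of "x - x1" z] by simp
    then show ?thesis
      using x1(1) by simp
  qed
  moreover have "J \<noteq> monomial_span Q"
    using \<open>0 \<notin> X\<close> one_in_monomial_span[of X] one_in_monomial_span[of Q] zero_NN[of A] unfolding J by metis
  ultimately have "primary_ideal J (semigroup_ring A)"
    using I nilP unfolding primary_ideal_def semigroup_ring_simps semigroup_ring_pow by blast
  then show ?thesis
    unfolding primary_to_def face_prime_eq[OF F] using rad by simp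
qed

end

section \<open>Pairs and divisibility modulo a face\<close>

context affine_semigroup
begin

lemma pointed_zero:
  assumes "x \<in> Q" "y \<in> Q" "x + y = 0"
  shows "x = 0"
  using face_summand[OF face_empty assms(1,2)] assms(3) by simp

lemma ZZ_mono: "F \<subseteq> G \<Longrightarrow> finite G \<Longrightarrow> ZZ F \<subseteq> ZZ G"
  using NN_mono[of F G] unfolding ZZ_eq by blast

lemma mem_pair_set: "x \<in> pair_set (a, F) \<longleftrightarrow> x - a \<in> NN F"
  by (auto simp: pair_set_def intro: exI[where x = "x - a"])

lemma pair_set_subset_iff:
  assumes F: "divisor_closed_face F" and G: "divisor_closed_face G"
  shows "pair_set (a, F) \<subseteq> pair_set (b, G) \<longleftrightarrow> F \<subseteq> G \<and> a - b \<in> NN G"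
proof
  assume sub: "pair_set (a, F) \<subseteq> pair_set (b, G)"
  have a: "a - b \<in> NN G"
    using subsetD[OF sub, of a] by (simp add: mem_pair_set)
  have "f \<in> G" if "f \<in> F" for f
  proof -
    have "f \<in> A"
      using that face_subset[OF F] by blast
    have "a + f \<in> pair_set (b, G)"
      using NN_gen[OF face_finite[OF F] that] by (intro subsetD[OF sub]) (simp add: mem_pair_set)
    then have "f + (a - b) \<in> NN G"
      by (simp add: mem_pair_set algebra_simps)
    then have "f \<in> NN G"
      using face_summand[OF G] NN_gen[OF finite_A \<open>f \<in> A\<close>] a face_NN_Q[OF G] by blast
    then show ?thesis
      using face_gen_iff[OF G \<open>f \<in> A\<close>] by blast
  qed
  then show "F \<subseteq> G \<and> a - b \<in> NN G"
    using a by blast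
next
  assume *: "F \<subseteq> G \<and> a - b \<in> NN G"
  show "pair_set (a, F) \<subseteq> pair_set (b, G)"
  proof
    fix x assume "x \<in> pair_set (a, F)"
    then have "x - a \<in> NN G"
      using NN_mono[OF _ face_finite[OF G]] * by (auto simp: mem_pair_set)
    then have "(x - a) + (a - b) \<in> NN G"
      using * by (intro NN_add) auto
    then show "x \<in> pair_set (b, G)"
      by (simp add: mem_pair_set)
  qed
qed

lemma NN_insert_cases:
  assumes "w \<in> NN (insert c F)" "finite F"
  obtains n where "w - int n *s c \<in> NN F"
proof -
  have "\<exists>n. w - int n *s c \<in> NN F"
    using assms(1)
  proof (rule NN_least)
    fix x y assume "\<exists>n. x - int n *s c \<in> NN F" "\<exists>n. y - int n *s c \<in> NN F"
    then obtain n m where "x - int n *s c \<in> NN F" "y - int m *s c \<in> NN F"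
      by blast
    then have "(x - int n *s c) + (y - int m *s c) \<in> NN F"
      by (rule NN_add)
    then have "(x + y) - int (n + m) *s c \<in> NN F"
      by (simp add: vector_sadd_rdistrib algebra_simps)
    then show "\<exists>n. x + y - int n *s c \<in> NN F"
      by blast
  next
    fix a assume "a \<in> insert c F"
    then show "\<exists>n. a - int n *s c \<in> NN F"
      using NN_gen[OF assms(2)] by (auto intro: exI[where x = 1] exI[where x = 0])
  qed (auto intro: exI[where x = 0])
  then show thesis
    using that by blast
qed

text \<open>The exponents that divide \<open>b\<close> after the elements of \<open>F\<close> have been made invertible. For a face \<open>F\<close>
these sets encode the order on overlap classes: \<open>lower F b\<close> determines the class of \<open>(b, F)\<close> and is
determined by it (\<open>lower_antisym\<close>, \<open>lower_cong\<close>), and divisibility of classes is inclusion.\<close>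

definition lower :: "(int ^ 'd) set \<Rightarrow> int ^ 'd \<Rightarrow> (int ^ 'd) set" where
  "lower F b = {x. \<exists>c\<in>Q. b - x - c \<in> ZZ F}"

lemma lowerI: "c \<in> Q \<Longrightarrow> b - x - c \<in> ZZ F \<Longrightarrow> x \<in> lower F b"
  unfolding lower_def by blast

lemma lower_refl: "b \<in> lower F b"
  using NN_ZZ[OF zero_NN, of F] by (intro lowerI[of 0]) auto

lemma lower_trans:
  assumes "x \<in> lower F y" "y \<in> lower F z"
  shows "x \<in> lower F z"
proof -
  obtain c d where cd: "c \<in> Q" "y - x - c \<in> ZZ F" "d \<in> Q" "z - y - d \<in> ZZ F"
    using assms unfolding lower_def by blast
  show ?thesis
  proof (rule lowerI)
    show "c + d \<in> Q"
      using cd by (intro NN_add)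
    show "z - x - (c + d) \<in> ZZ F"
      using ZZ_add[OF cd(2,4)] by (simp add: algebra_simps)
  qed
qed

lemma lower_cong:
  assumes "b - b' \<in> ZZ F"
  shows "lower F b = lower F b'"
proof -
  have "b \<in> lower F b'" "b' \<in> lower F b"
    using assms ZZ_minus_commute[OF assms] by (auto intro!: lowerI[of 0])
  then show ?thesis
    using lower_trans by blast
qed

text \<open>Mutual divisibility puts a sum \<open>c + d\<close> of monoid elements into \<open>ZZ F\<close>, hence into \<open>NN F\<close>; as \<open>F\<close> is
a face, both summands lie in \<open>NN F\<close>.\<close>

lemma lower_antisym:
  assumes F: "divisor_closed_face F" and "lower F b = lower F b'"
  shows "b - b' \<in> ZZ F"
proof -
  have "b' \<in> lower F b" "b \<in> lower F b'"
    using assms(2) lower_refl by auto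
  then obtain c d where cd: "c \<in> Q" "b - b' - c \<in> ZZ F" "d \<in> Q" "b' - b - d \<in> ZZ F"
    unfolding lower_def by blast
  have "- ((b - b' - c) + (b' - b - d)) \<in> ZZ F"
    by (intro ZZ_uminus ZZ_add cd)
  then have "c + d \<in> ZZ F"
    by (simp add: algebra_simps)
  then have "c + d \<in> NN F"
    using cd by (intro face_ZZ_Q[OF F] NN_add)
  then have "c \<in> ZZ F"
    using face_summand[OF F cd(1,3)] NN_ZZ by blast
  then show ?thesis
    using ZZ_add[OF cd(2)] by force
qed

end

section \<open>Standard pairs\<close>

locale monomial_ideal_of_semigroup = affine_semigroup A for A :: "(int ^ 'd) set" +
  fixes I :: "(int ^ 'd \<Rightarrow>\<^sub>0 'k::field) set"
  assumes monomial: "monomial_ideal A I"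
begin

lemma std_subset: "std A I \<subseteq> Q"
  by (auto simp: std_def)

lemma std_divisor:
  assumes "x \<in> Q" "y \<in> Q" "x + y \<in> std A I"
  shows "x \<in> std A I"
  using monomial_ideal_eq(1)[OF monomial] assms unfolding absorbing_def by blast

text \<open>The points that form a proper pair with the face \<open>F\<close>, see \<open>proper_pair_iff\<close>.\<close>

definition bases :: "(int ^ 'd) set \<Rightarrow> (int ^ 'd) set" where
  "bases F = {b \<in> Q. \<forall>f\<in>NN F. b + f \<in> std A I}"

lemma bases_Q: "b \<in> bases F \<Longrightarrow> b \<in> Q"
  by (simp add: bases_def)

lemma bases_std: "b \<in> bases F \<Longrightarrow> b \<in> std A I"
  unfolding bases_def using zero_NN[of F] by (metis (mono_tags, lifting) add.right_neutral mem_Collect_eq)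

text \<open>A negative contribution \<open>- v\<close> from \<open>ZZ F\<close> can be moved to the factor \<open>c\<close>: then \<open>b + f\<close> divides
\<open>b' + (u + f)\<close>, which is standard. Thus being a base point passes to divisors modulo \<open>ZZ F\<close>.\<close>

lemma bases_saturated:
  assumes F: "divisor_closed_face F" and "b \<in> Q" "c \<in> Q" and b': "b' \<in> bases F"
    and "b + c - b' \<in> ZZ F"
  shows "b \<in> bases F"
proof -
  obtain u v where uv: "b + c - b' = u - v" "u \<in> NN F" "v \<in> NN F"
    using assms(5) unfolding ZZ_eq by blast
  have "b + f \<in> std A I" if f: "f \<in> NN F" for f
  proof (rule std_divisor)
    show "b + f \<in> Q" "c + v \<in> Q"
      using assms f uv(3) face_NN_Q[OF F] by (auto intro: NN_add)
    have "(b + f) + (c + v) = b' + (u + f)"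
      using uv(1) by (simp add: algebra_simps)
    moreover have "b' + (u + f) \<in> std A I"
      using b' NN_add[OF uv(2) f] by (auto simp: bases_def)
    ultimately show "(b + f) + (c + v) \<in> std A I"
      by (simp only:)
  qed
  then show ?thesis
    using \<open>b \<in> Q\<close> by (simp add: bases_def)
qed

lemma bases_lower:
  assumes F: "divisor_closed_face F" and b: "b \<in> bases F" and "x \<in> Q" "x \<in> lower F b"
  shows "x \<in> bases F"
proof -
  obtain c where c: "c \<in> Q" "b - x - c \<in> ZZ F"
    using assms unfolding lower_def by blast
  show ?thesis
    using bases_saturated[OF F \<open>x \<in> Q\<close> c(1) b] ZZ_uminus[OF c(2)] by (simp add: algebra_simps)
qed

lemma bases_divisor:
  assumes "divisor_closed_face F" "b \<in> bases F" "x \<in> Q" "b - x \<in> Q"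
  shows "x \<in> bases F"
  by (rule bases_lower[OF assms(1-3)]) (use assms(4) NN_ZZ[OF zero_NN, of F] in \<open>auto intro: lowerI\<close>)

lemma proper_pair_iff: "proper_pair A I (a, F) \<longleftrightarrow> divisor_closed_face F \<and> a \<in> bases F"
  unfolding proper_pair_def is_pair_def is_face_iff bases_def pair_set_def by auto

text \<open>What remains of maximality of \<open>(a, F)\<close> when only larger faces at the same base point are
considered. Within the monoid this is, in contrast to being standard, a property of the class of \<open>a\<close>
modulo \<open>ZZ F\<close>.\<close>

definition isolated :: "(int ^ 'd) set \<Rightarrow> int ^ 'd \<Rightarrow> bool" where
  "isolated F a \<longleftrightarrow> a \<in> bases F \<and> (\<forall>G. divisor_closed_face G \<and> F \<subseteq> G \<and> a \<in> bases G \<longrightarrow> G = F)"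

lemma standard_pair_iff:
  "standard_pair A I (a, F) \<longleftrightarrow> divisor_closed_face F \<and> a \<in> bases F \<and>
     (\<forall>b G. divisor_closed_face G \<and> b \<in> bases G \<and> F \<subseteq> G \<and> a - b \<in> NN G \<longrightarrow> b = a \<and> G = F)"
  unfolding standard_pair_def split_paired_All proper_pair_iff prod.inject
  by (simp add: pair_set_subset_iff conj_assoc cong: conj_cong)

lemma standard_pair_isolated:
  assumes "standard_pair A I (a, F)"
  shows "isolated F a"
  using assms unfolding standard_pair_iff isolated_def by (metis diff_self zero_NN)

lemma standard_pair_face: "standard_pair A I (a, F) \<Longrightarrow> divisor_closed_face F"
  by (simp add: standard_pair_iff)

lemma standard_pair_base: "standard_pair A I (a, F) \<Longrightarrow> a \<in> bases F"
  by (simp add: standard_pair_iff)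

lemma standard_pair_Q: "standard_pair A I (a, F) \<Longrightarrow> a \<in> Q"
  using standard_pair_base bases_Q by blast

text \<open>A larger pair has a base point dividing \<open>a\<close>, so there are only finitely many of them, and one of
them has a maximal point set.\<close>

lemma proper_pair_in_standard_pair:
  assumes F: "divisor_closed_face F" and a: "a \<in> bases F"
  obtains b G where "standard_pair A I (b, G)" "F \<subseteq> G" "a - b \<in> NN G"
proof -
  define M where "M = {(b, G). divisor_closed_face G \<and> b \<in> bases G \<and> F \<subseteq> G \<and> a - b \<in> NN G}"
  have "M \<subseteq> {y \<in> Q. a - y \<in> Q} \<times> Pow A"
    using bases_Q face_NN_Q face_subset unfolding M_def by fast
  moreover have "finite ({y \<in> Q. a - y \<in> Q} \<times> Pow A)"
    using finite_divisors[OF bases_Q[OF a]] finite_A by simp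
  ultimately have "finite M"
    by (rule finite_subset)
  moreover have "(a, F) \<in> M"
    using assms by (simp add: M_def)
  ultimately obtain X where "X \<in> pair_set ` M" and max: "\<forall>Y\<in>pair_set ` M. X \<subseteq> Y \<longrightarrow> X = Y"
    using finite_has_maximal2[of "pair_set ` M"] by (metis finite_imageI imageI)
  then obtain b G where bG: "(b, G) \<in> M" "X = pair_set (b, G)"
    by auto
  have G: "divisor_closed_face G" "b \<in> bases G" "F \<subseteq> G" "a - b \<in> NN G"
    using bG(1) by (auto simp: M_def)
  have "b' = b \<and> G' = G"
    if G': "divisor_closed_face G'" "b' \<in> bases G'" "G \<subseteq> G'" "b - b' \<in> NN G'" for b' G'
  proof -
    have "(a - b) + (b - b') \<in> NN G'"
      using G(4) G'(4) NN_mono[OF G'(3) face_finite[OF G'(1)]] by (intro NN_add) auto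
    then have "(b', G') \<in> M"
      using G G' by (auto simp: M_def)
    moreover have "X \<subseteq> pair_set (b', G')"
      unfolding bG(2) using pair_set_subset_iff[OF G(1) G'(1)] G'(3,4) by blast
    ultimately have "X = pair_set (b', G')"
      using max by blast
    then have "G' \<subseteq> G" "b' - b \<in> NN G"
      using pair_set_subset_iff[OF G'(1) G(1), of b' b] unfolding bG(2) by blast+
    moreover have "b - b' = 0"
      using pointed_zero[of "b - b'" "b' - b"] face_NN_Q[OF G(1)] face_NN_Q[OF G'(1)]
        \<open>b' - b \<in> NN G\<close> G'(4) by auto
    ultimately show ?thesis
      using G'(3) by auto
  qed
  then have "standard_pair A I (b, G)"
    unfolding standard_pair_iff using G by blast
  then show thesis
    using that G by blast
qed

text \<open>Otherwise \<open>a\<close> would be a base point for the smallest face \<open>G\<close> containing \<open>F\<close> and \<open>c\<close>, since every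
element of \<open>NN G\<close> divides some \<open>n *s c + f\<close> with \<open>f \<in> NN F\<close>.\<close>

lemma isolated_escape:
  assumes F: "divisor_closed_face F" and a: "isolated F a" and c: "c \<in> A - F"
  obtains n where "a + int n *s c \<notin> bases F"
proof -
  have "\<exists>n. a + int n *s c \<notin> bases F"
  proof (rule ccontr)
    assume "\<nexists>n. a + int n *s c \<notin> bases F"
    then have all: "a + int n *s c \<in> bases F" for n
      by blast
    have fin: "finite (insert c F)" "insert c F \<subseteq> A"
      using face_finite[OF F] face_subset[OF F] c by auto
    \<comment> \<open>The generators that divide some element of \<open>NN (insert c F)\<close>: the smallest face containing
      \<open>insert c F\<close>.\<close>
    define G where "G = {g \<in> A. \<exists>w\<in>NN (insert c F). w - g \<in> Q}"
    have bound: "\<exists>w\<in>NN (insert c F). w - y \<in> Q" if "y \<in> NN G" for y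
      using that
    proof (rule NN_least)
      show "\<exists>w\<in>NN (insert c F). w - 0 \<in> Q"
        by (rule bexI[where x = 0]) auto
      fix x y assume "\<exists>w\<in>NN (insert c F). w - x \<in> Q" "\<exists>w\<in>NN (insert c F). w - y \<in> Q"
      then obtain w w' where "w \<in> NN (insert c F)" "w - x \<in> Q" "w' \<in> NN (insert c F)" "w' - y \<in> Q"
        by blast
      then have "w + w' \<in> NN (insert c F)" "(w - x) + (w' - y) \<in> Q"
        by (auto intro: NN_add)
      then show "\<exists>w\<in>NN (insert c F). w - (x + y) \<in> Q"
        by (intro bexI[where x = "w + w'"]) (auto simp: algebra_simps)
    qed (auto simp: G_def)
    have "divisor_closed_face G"
      unfolding divisor_closed_face_def
    proof (intro conjI ballI impI)
      fix g x assume g: "g \<in> A" and x: "x \<in> Q" and "g + x \<in> NN G"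
      then obtain w where "w \<in> NN (insert c F)" "w - (g + x) \<in> Q"
        using bound by blast
      moreover have "w - g = (w - (g + x)) + x"
        by simp
      ultimately show "g \<in> G"
        unfolding G_def using g x NN_add by (metis (mono_tags, lifting) mem_Collect_eq)
    qed (auto simp: G_def)
    moreover have sub: "insert c F \<subseteq> G"
    proof
      fix g assume "g \<in> insert c F"
      then show "g \<in> G"
        using NN_gen[OF fin(1)] fin(2) unfolding G_def by (auto intro!: bexI[where x = g])
    qed
    moreover have "a \<in> bases G"
      unfolding bases_def
    proof (intro CollectI conjI ballI)
      show "a \<in> Q"
        using a bases_Q by (auto simp: isolated_def)
      fix y assume y: "y \<in> NN G"
      obtain w where w: "w \<in> NN (insert c F)" "w - y \<in> Q"
        using bound[OF y] by blast
      obtain n where n: "w - int n *s c \<in> NN F"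
        using NN_insert_cases[OF w(1) face_finite[OF F]] by blast
      have "(a + int n *s c) + (w - int n *s c) \<in> std A I"
        using all[of n] n unfolding bases_def by blast
      then have "(a + y) + (w - y) \<in> std A I"
        by simp
      moreover have "y \<in> Q"
        using y NN_mono[of G A] finite_A by (auto simp: G_def)
      ultimately show "a + y \<in> std A I"
        using \<open>a \<in> Q\<close> w(2) by (intro std_divisor[of "a + y" "w - y"] NN_add)
    qed
    ultimately have "G = F"
      using a unfolding isolated_def by blast
    then show False
      using sub c by blast
  qed
  then show thesis
    using that by blast
qed

section \<open>Overlap classes of standard pairs\<close>

text \<open>Modulo \<open>ZZ F\<close> a class above \<open>a\<close> is reached from \<open>a\<close> by adding multiples of the \<open>c \<in> A - F\<close>, and
\<open>isolated_escape\<close> bounds each of these multiples.\<close>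

lemma finitely_many_classes_above:
  assumes F: "divisor_closed_face F" and a: "isolated F a"
  shows "finite (lower F ` {b \<in> bases F. a \<in> lower F b})"
proof -
  have aQ: "a \<in> Q"
    using a bases_Q by (auto simp: isolated_def)
  have "\<forall>c. \<exists>n. c \<in> A - F \<longrightarrow> a + int n *s c \<notin> bases F"
    using isolated_escape[OF F a] by metis
  then obtain N where N: "\<And>c. c \<in> A - F \<Longrightarrow> a + int (N c) *s c \<notin> bases F"
    by metis
  define val where "val n = a + (\<Sum>c\<in>A - F. int (n c) *s c)" for n :: "int ^ 'd \<Rightarrow> nat"
  have "lower F ` {b \<in> bases F. a \<in> lower F b}
      \<subseteq> (\<lambda>n. lower F (val n)) ` (\<Pi>\<^sub>E c\<in>A - F. {..<N c})"
  proof (rule image_subsetI)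
    fix b assume "b \<in> {b \<in> bases F. a \<in> lower F b}"
    then obtain c where b: "b \<in> bases F" and c: "c \<in> Q" "b - a - c \<in> ZZ F"
      unfolding lower_def by blast
    obtain n where n: "c - (\<Sum>c\<in>A - F. int (n c) *s c) \<in> NN F"
      using decompose_along_face[OF face_subset[OF F] c(1)] by blast
    have bv: "b - val n \<in> ZZ F"
      using ZZ_add[OF c(2) NN_ZZ[OF n]] by (simp add: val_def algebra_simps)
    have "n e < N e" if e: "e \<in> A - F" for e
    proof (rule ccontr)
      assume "\<not> n e < N e"
      define r where "r = int (n e - N e) *s e + (\<Sum>c\<in>A - F - {e}. int (n c) *s c)"
      have eQ: "e \<in> Q"
        using e NN_gen[OF finite_A] by blast
      have r: "r \<in> Q"
        unfolding r_def using eQ NN_gen[OF finite_A]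
        by (intro NN_add NN_sum NN_scale) auto
      have "val n = (a + int (N e) *s e) + r"
        using sum.remove[of "A - F" e "\<lambda>c. int (n c) *s c"] e finite_A \<open>\<not> n e < N e\<close>
        by (simp add: val_def r_def of_nat_diff vector_sub_rdistrib)
      then have "(a + int (N e) *s e) + r - b \<in> ZZ F"
        using ZZ_minus_commute[OF bv] by simp
      then have "a + int (N e) *s e \<in> bases F"
        using bases_saturated[OF F _ r b] NN_add[OF aQ NN_scale[OF eQ]] by blast
      then show False
        using N[OF e] by blast
    qed
    then have "restrict n (A - F) \<in> (\<Pi>\<^sub>E c\<in>A - F. {..<N c})"
      by auto
    moreover have "val (restrict n (A - F)) = val n"
      unfolding val_def by (intro arg_cong[where f = "(+) a"] sum.cong) auto
    ultimately show "lower F b \<in> (\<lambda>n. lower F (val n)) ` (\<Pi>\<^sub>E c\<in>A - F. {..<N c})"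
      using lower_cong[OF bv] by (metis imageI)
  qed
  then show ?thesis
    by (rule finite_subset) (use finite_A in \<open>intro finite_imageI finite_PiE; auto\<close>)
qed

text \<open>The exponents \<open>W\<close> that are base points for no larger face form an ideal of the monoid, with finitely
many generators by Dickson's lemma. An isolated point lies above a generator, which is then isolated
too, and only finitely many classes lie above that.\<close>

lemma finitely_many_isolated_classes:
  assumes F: "divisor_closed_face F"
  shows "finite (lower F ` {a. isolated F a})"
proof -
  define W where "W = {b \<in> Q. \<forall>G. divisor_closed_face G \<and> F \<subset> G \<longrightarrow> b \<notin> bases G}"
  have iso: "isolated F b \<longleftrightarrow> b \<in> bases F \<and> b \<in> W" for b
    using bases_Q unfolding isolated_def W_def by blast
  obtain V where V: "V \<subseteq> W" "finite V" "\<And>u. u \<in> W \<Longrightarrow> \<exists>v\<in>V. u - v \<in> Q"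
    using finitely_many_minimal[of W] unfolding W_def by blast
  have "lower F ` {a. isolated F a}
      \<subseteq> (\<Union>v\<in>{v \<in> V. isolated F v}. lower F ` {b \<in> bases F. v \<in> lower F b})"
  proof (rule image_subsetI)
    fix a assume "a \<in> {a. isolated F a}"
    then have a: "a \<in> bases F" "a \<in> W"
      using iso by auto
    obtain v where v: "v \<in> V" "a - v \<in> Q"
      using V(3)[OF a(2)] by blast
    then have "v \<in> Q"
      using V(1) by (auto simp: W_def)
    then have "isolated F v"
      using bases_divisor[OF F a(1) _ v(2)] v(1) V(1) iso by blast
    moreover have "v \<in> lower F a"
      using v(2) NN_ZZ[OF zero_NN, of F] by (auto intro: lowerI)
    ultimately show "lower F a \<in> (\<Union>v\<in>{v \<in> V. isolated F v}. lower F ` {b \<in> bases F. v \<in> lower F b})"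
      using v(1) a(1) by blast
  qed
  then show ?thesis
    by (rule finite_subset) (use V(2) finitely_many_classes_above[OF F] in auto)
qed

lemma overlap_class_eq_iff:
  assumes "is_pair A (a, F)" "is_pair A (b, F)"
  shows "overlap_class A (a, F) = overlap_class A (b, F) \<longleftrightarrow> b - a \<in> ZZ F"
proof
  assume "overlap_class A (a, F) = overlap_class A (b, F)"
  moreover have "(a, F) \<in> overlap_class A (a, F)"
    using assms(1) NN_ZZ[OF zero_NN, of F] by (simp add: overlap_class_def overlap_def)
  ultimately show "b - a \<in> ZZ F"
    by (simp add: overlap_class_def overlap_def)
next
  assume ba: "b - a \<in> ZZ F"
  have "a - x \<in> ZZ F \<longleftrightarrow> b - x \<in> ZZ F" for x
    using ZZ_add[OF ba, of "a - x"] ZZ_sub[of "b - x" F "b - a", OF _ ba] by auto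
  then show "overlap_class A (a, F) = overlap_class A (b, F)"
    by (auto simp: overlap_class_def overlap_def)
qed

lemma standard_pair_is_pair: "standard_pair A I p \<Longrightarrow> is_pair A p"
  by (simp add: standard_pair_def proper_pair_def)

text \<open>If \<open>(a, F)\<close> divides \<open>(b, G)\<close>, then \<open>F \<subseteq> G\<close> and \<open>a\<close> divides \<open>b\<close> modulo \<open>ZZ G\<close>, so that \<open>a\<close> is a base
point for \<open>G\<close>. As \<open>(a, F)\<close> is standard, this forces \<open>G = F\<close>: classes of standard pairs that
belong to different faces are never comparable.\<close>

lemma class_divides_iff:
  assumes a: "standard_pair A I (a, F)" and b: "standard_pair A I (b, G)"
  shows "class_divides A (overlap_class A (a, F)) (overlap_class A (b, G)) \<longleftrightarrow> G = F \<and> a \<in> lower F b"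
proof
  note F = standard_pair_face[OF a] and G = standard_pair_face[OF b]
  have shift: "(\<lambda>x. c + x) ` pair_set (a', F) = pair_set (c + a', F)" for c a'
    unfolding pair_set_def by (auto simp: image_def add.assoc)
  {
    assume "class_divides A (overlap_class A (a, F)) (overlap_class A (b, G))"
    then obtain a1 b1 c where 1: "a - a1 \<in> ZZ F" "b - b1 \<in> ZZ G" "c \<in> Q"
      "pair_set (c + a1, F) \<subseteq> pair_set (b1, G)"
      unfolding class_divides_def pair_divides_def overlap_class_def overlap_def
      by (auto simp: shift)
    then have FG: "F \<subseteq> G" and 2: "c + a1 - b1 \<in> NN G"
      using pair_set_subset_iff[OF F G] by auto
    have "(a - a1) + (c + a1 - b1) - (b - b1) \<in> ZZ G"
      by (rule ZZ_sub[OF ZZ_add[OF subsetD[OF ZZ_mono[OF FG face_finite[OF G]] 1(1)] NN_ZZ[OF 2]] 1(2)])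
    then have acb: "a + c - b \<in> ZZ G"
      by (simp add: algebra_simps)
    then have "a \<in> bases G"
      using bases_saturated[OF G standard_pair_Q[OF a] 1(3) standard_pair_base[OF b]] by blast
    then have "G = F"
      using standard_pair_isolated[OF a] FG G unfolding isolated_def by blast
    moreover have "a \<in> lower G b"
      using ZZ_uminus[OF acb] 1(3) by (auto intro!: lowerI simp: algebra_simps)
    ultimately show "G = F \<and> a \<in> lower F b"
      by blast
  }
  assume "G = F \<and> a \<in> lower F b"
  then obtain c where GF: "G = F" and c: "c \<in> Q" "b - a - c \<in> ZZ F"
    unfolding lower_def by blast
  obtain u v where uv: "b - a - c = u - v" "u \<in> NN F" "v \<in> NN F"
    using c(2) unfolding ZZ_eq by blast
  have "(c + u) + a - b = v"
    using uv(1) by (simp add: algebra_simps)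
  then have "pair_set ((c + u) + a, F) \<subseteq> pair_set (b, F)"
    using pair_set_subset_iff[OF F F] uv(3) by simp
  moreover have "c + u \<in> Q"
    using c(1) uv(2) face_NN_Q[OF F] by (auto intro: NN_add)
  ultimately have "pair_divides A (a, F) (b, F)"
    unfolding pair_divides_def shift by blast
  moreover have "(a, F) \<in> overlap_class A (a, F)" "(b, F) \<in> overlap_class A (b, F)"
    using standard_pair_is_pair[OF a] standard_pair_is_pair[OF b] NN_ZZ[OF zero_NN, of F] GF
    by (auto simp: overlap_class_def overlap_def)
  ultimately show "class_divides A (overlap_class A (a, F)) (overlap_class A (b, G))"
    unfolding class_divides_def GF by blast
qed

lemma maximal_class_iff:
  assumes a: "standard_pair A I (a, F)"
  shows "maximal_class A I (overlap_class A (a, F)) \<longleftrightarrow>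
    (\<forall>b. standard_pair A I (b, F) \<and> a \<in> lower F b \<longrightarrow> b - a \<in> ZZ F)"
proof -
  have "maximal_class A I (overlap_class A (a, F)) \<longleftrightarrow>
    (\<forall>b G. standard_pair A I (b, G) \<and> class_divides A (overlap_class A (a, F)) (overlap_class A (b, G))
       \<longrightarrow> overlap_class A (b, G) = overlap_class A (a, F))"
    using a unfolding maximal_class_def standard_classes_def by fast
  also have "\<dots> \<longleftrightarrow> (\<forall>b. standard_pair A I (b, F) \<and> a \<in> lower F b
       \<longrightarrow> overlap_class A (b, F) = overlap_class A (a, F))"
    using class_divides_iff[OF a] by blast
  also have "\<dots> \<longleftrightarrow> (\<forall>b. standard_pair A I (b, F) \<and> a \<in> lower F b \<longrightarrow> b - a \<in> ZZ F)"
    using overlap_class_eq_iff[OF standard_pair_is_pair[OF a] standard_pair_is_pair] by blast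
  finally show ?thesis .
qed

text \<open>Maximality among all standard classes is the same as maximality among the finitely many that
belong to \<open>F\<close>. This is why every face in \<open>standard_faces A I\<close> has a maximal class.\<close>

lemma maximal_class_above:
  assumes a: "standard_pair A I (a, F)"
  obtains b where "standard_pair A I (b, F)" "a \<in> lower F b"
    "maximal_class A I (overlap_class A (b, F))"
proof -
  note F = standard_pair_face[OF a]
  define L where "L = lower F ` {b. standard_pair A I (b, F)}"
  have "finite L"
    by (rule finite_subset[OF _ finitely_many_isolated_classes[OF F]])
      (use standard_pair_isolated in \<open>auto simp: L_def\<close>)
  moreover have "lower F a \<in> L"
    using a by (simp add: L_def)
  ultimately obtain X where X: "X \<in> L" "lower F a \<subseteq> X" "\<forall>Y\<in>L. X \<subseteq> Y \<longrightarrow> X = Y"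
    using finite_has_maximal2[of L "lower F a"] by blast
  then obtain b where b: "standard_pair A I (b, F)" "X = lower F b"
    by (auto simp: L_def)
  have "maximal_class A I (overlap_class A (b, F))"
    unfolding maximal_class_iff[OF b(1)]
  proof (intro allI impI)
    fix b' assume b': "standard_pair A I (b', F) \<and> b \<in> lower F b'"
    then have "lower F b \<subseteq> lower F b'" "lower F b' \<in> L"
      using lower_trans by (auto simp: L_def)
    then have "lower F b' = lower F b"
      using X(3) b(2) by blast
    then show "b' - b \<in> ZZ F"
      by (rule lower_antisym[OF F])
  qed
  then show thesis
    using that[OF b(1)] X(2) b(2) lower_refl by blast
qed

end

section \<open>The components\<close>

context affine_semigroup
begin

lemma face_prime_subset_iff:
  assumes "divisor_closed_face F" "divisor_closed_face G"
  shows "(face_prime A F :: (int ^ 'd \<Rightarrow>\<^sub>0 'k::field) set) \<subseteq> face_prime A G \<longleftrightarrow> G \<subseteq> F"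
proof -
  have "(monomial_span (Q - NN F) :: (int ^ 'd \<Rightarrow>\<^sub>0 'k) set) \<subseteq> monomial_span (Q - NN G) \<longleftrightarrow> Q - NN F \<subseteq> Q - NN G"
    using monomial_span_mono mon_in_monomial_span by (metis subsetD subsetI)
  also have "\<dots> \<longleftrightarrow> G \<subseteq> F"
    using face_NN_subset_iff[OF assms(2,1)] face_NN_Q[OF assms(2)] by blast
  finally show ?thesis
    by (simp add: face_prime_eq assms)
qed

end

context monomial_ideal_of_semigroup
begin

lemma standard_faces_iff: "F \<in> standard_faces A I \<longleftrightarrow> (\<exists>a. standard_pair A I (a, F))"
  using standard_pair_face is_face_iff unfolding standard_faces_def by blast

lemma standard_faces_face: "F \<in> standard_faces A I \<Longrightarrow> divisor_closed_face F"
  using standard_pair_face standard_faces_iff by blast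

lemma finite_standard_faces: "finite (standard_faces A I)"
  by (rule finite_subset[of _ "Pow A"]) (use standard_faces_face face_subset finite_A in auto)

definition component_std :: "(int ^ 'd) set \<Rightarrow> (int ^ 'd) set" where
  "component_std F = {b \<in> NN A. \<exists>a. standard_pair A I (a, F) \<and>
     maximal_class A I (overlap_class A (a, F)) \<and> (\<exists>x\<in>pair_set (a, F). x - b \<in> NN A)}"

lemma component_std_divisor:
  assumes "x \<in> Q" "y \<in> Q" "x + y \<in> component_std F"
  shows "x \<in> component_std F"
proof -
  obtain a z where az: "standard_pair A I (a, F)" "maximal_class A I (overlap_class A (a, F))"
      "z \<in> pair_set (a, F)" "z - (x + y) \<in> Q"
    using assms(3) unfolding component_std_def by blast
  have "z - x = (z - (x + y)) + y"
    by simp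
  then have "z - x \<in> Q"
    using NN_add[OF az(4) assms(2)] by (simp only:)
  then show ?thesis
    unfolding component_std_def using az assms(1) by blast
qed

lemma component_std_bases:
  assumes "b \<in> component_std F"
  shows "b \<in> bases F"
proof -
  obtain a x where a: "standard_pair A I (a, F)" and x: "x - a \<in> NN F" "x - b \<in> Q" and b: "b \<in> Q"
    using assms unfolding component_std_def by (auto simp: mem_pair_set)
  have "b + (x - b) - a \<in> ZZ F"
    using NN_ZZ[OF x(1)] by simp
  then show ?thesis
    by (rule bases_saturated[OF standard_pair_face[OF a] b x(2) standard_pair_base[OF a]])
qed

lemma component_std_stable:
  assumes F: "divisor_closed_face F" and "b \<in> component_std F" "f \<in> NN F"
  shows "b + f \<in> component_std F"
proof -
  obtain a z where az: "standard_pair A I (a, F)" "maximal_class A I (overlap_class A (a, F))"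
      "z - a \<in> NN F" "z - b \<in> Q" "b \<in> Q"
    using assms(2) unfolding component_std_def by (auto simp: mem_pair_set)
  have "z + f \<in> pair_set (a, F)"
    using NN_add[OF az(3) assms(3)] by (simp add: mem_pair_set algebra_simps)
  moreover have "(z + f) - (b + f) \<in> Q" "b + f \<in> Q"
    using az assms(3) face_NN_Q[OF F] by (auto intro: NN_add)
  ultimately show ?thesis
    unfolding component_std_def using az by blast
qed

text \<open>The degree of \<open>face_weight\<close> depends only on the class modulo \<open>ZZ F\<close>, so on the isolated points, which
form finitely many classes, it is bounded by some \<open>M\<close>, and then on all of \<open>component_std F\<close>. But the degree of \<open>c\<close>
is positive.\<close>

lemma component_std_power_escape:
  assumes F: "divisor_closed_face F" and c: "c \<in> Q" "c \<notin> NN F"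
  obtains n where "n > 0" "int n *s c \<notin> component_std F"
proof -
  obtain w :: "int ^ 'd \<Rightarrow> real" where w: "\<And>x y. w (x + y) = w x + w y"
    "\<And>n x. w (int n *s x) = real n * w x" "\<And>x. x \<in> NN F \<Longrightarrow> w x = 0"
    "\<And>x. x \<in> Q \<Longrightarrow> 0 \<le> w x" "\<And>c. c \<in> A - F \<Longrightarrow> 0 < w c"
    using face_weight[OF F] by metis
  have w_cong: "w a = w b" if ab: "a - b \<in> ZZ F" for a b
  proof -
    obtain u v where uv: "a - b = u - v" "u \<in> NN F" "v \<in> NN F"
      using ab unfolding ZZ_eq by blast
    then have "a + v = b + u"
      by (simp add: algebra_simps)
    then have "w a + w v = w b + w u"
      using w(1) by metis
    then show ?thesis
      using w(3) uv by simp
  qed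
  obtain C where C: "finite C" "lower F ` {a. isolated F a} = lower F ` C"
    using finite_subset_image[OF finitely_many_isolated_classes[OF F] subset_refl] by metis
  define M where "M = (\<Sum>a\<in>C. \<bar>w a\<bar>)"
  have wM: "w a \<le> M" if "isolated F a" for a
  proof -
    have "lower F a \<in> lower F ` C"
      using that C(2) by blast
    then obtain a' where a': "a' \<in> C" "lower F a = lower F a'"
      by blast
    have "w a = w a'"
      by (rule w_cong[OF lower_antisym[OF F a'(2)]])
    also have "\<dots> \<le> \<bar>w a'\<bar>"
      by simp
    also have "\<dots> \<le> M"
      unfolding M_def using C(1) a'(1) by (intro member_le_sum) auto
    finally show ?thesis .
  qed
  obtain e where e: "e \<in> A - F" "c - e \<in> Q"
    using nonface_divisor[OF F c] by blast
  have "w c = w e + w (c - e)"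
    using w(1)[of e "c - e"] by simp
  then have "0 < w c"
    using w(4)[OF e(2)] w(5)[OF e(1)] by simp
  then obtain n where n: "M < real n * w c"
    using reals_Archimedean3 by blast
  moreover have "0 \<le> M"
    by (auto simp: M_def intro: sum_nonneg)
  ultimately have "n > 0"
    by (cases n) auto
  moreover have "int n *s c \<notin> component_std F"
  proof
    assume "int n *s c \<in> component_std F"
    then obtain a x where a: "standard_pair A I (a, F)" and x: "x - a \<in> NN F" "x - int n *s c \<in> Q"
      unfolding component_std_def by (auto simp: mem_pair_set)
    have "w x = real n * w c + w (x - int n *s c)"
      using w(1)[of "int n *s c" "x - int n *s c"] w(2) by simp
    moreover have "w x = w a"
      using w(1)[of a "x - a"] w(3)[OF x(1)] by simp
    ultimately show False
      using wM[OF standard_pair_isolated[OF a]] w(4)[OF x(2)] n by simp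
  qed
  ultimately show thesis
    using that by blast
qed

lemma absorbing_component: "absorbing A (Q - component_std F)"
  unfolding absorbing_def using component_std_divisor NN_add by blast

lemma component_std_subset: "component_std F \<subseteq> Q"
  by (auto simp: component_std_def)

lemma face_component_eq: "face_component A I F = monomial_span (Q - component_std F)"
  unfolding face_component_def component_std_def[symmetric]
proof (rule the_equality)
  show "monomial_ideal A (monomial_span (Q - component_std F)) \<and>
      std A (monomial_span (Q - component_std F)) = component_std F"
    using absorbing_component component_std_subset
    by (auto simp: monomial_ideal_iff std_monomial_span)
  fix J :: "(int ^ 'd \<Rightarrow>\<^sub>0 'k) set"
  assume "monomial_ideal A J \<and> std A J = component_std F"
  then show "J = monomial_span (Q - component_std F)"
    using monomial_ideal_eq(2)[of A J] by simp
qed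

lemma component_std_zero: "F \<in> standard_faces A I \<Longrightarrow> 0 \<in> component_std F"
proof -
  assume "F \<in> standard_faces A I"
  then obtain a where a: "standard_pair A I (a, F)" "maximal_class A I (overlap_class A (a, F))"
    using maximal_class_above unfolding standard_faces_iff by metis
  have "a \<in> pair_set (a, F)" "a - 0 \<in> Q"
    using standard_pair_Q[OF a(1)] by (auto simp: mem_pair_set)
  then show ?thesis
    unfolding component_std_def using a zero_NN by blast
qed

lemma face_component_primary:
  assumes "F \<in> standard_faces A I"
  shows "primary_to (face_prime A F) (face_component A I F) (semigroup_ring A)"
proof (rule monomial_primary[OF standard_faces_face[OF assms] absorbing_component _ _ _ face_component_eq])
  note F = standard_faces_face[OF assms]
  show "0 \<notin> Q - component_std F"
    using component_std_zero[OF assms] by blast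
  show "s + f \<notin> Q - component_std F" if "s \<in> Q - (Q - component_std F)" "f \<in> NN F" for s f
    using component_std_stable[OF F _ that(2), of s] that(1) by blast
  show "\<exists>n>0. int n *s c \<in> Q - component_std F" if "c \<in> Q - NN F" for c
    using component_std_power_escape[OF F, of c] NN_scale[of c A] that by blast
qed

text \<open>A standard exponent \<open>b\<close> lies in a standard pair \<open>(a, F)\<close>. Passing to a pair with maximal class above
it, \<open>b\<close> may no longer belong to the pair, but it divides an element of it.\<close>

lemma std_eq_Union_components: "std A I = (\<Union>F\<in>standard_faces A I. component_std F)"
proof
  show "(\<Union>F\<in>standard_faces A I. component_std F) \<subseteq> std A I"
    using component_std_bases bases_std by blast
  show "std A I \<subseteq> (\<Union>F\<in>standard_faces A I. component_std F)"
  proof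
    fix b assume b: "b \<in> std A I"
    then have "b \<in> bases {}"
      using std_subset by (auto simp: bases_def)
    then obtain a F where a: "standard_pair A I (a, F)" "b - a \<in> NN F"
      using proper_pair_in_standard_pair[OF face_empty] by blast
    note F = standard_pair_face[OF a(1)]
    obtain a' where a': "standard_pair A I (a', F)" "a \<in> lower F a'"
        "maximal_class A I (overlap_class A (a', F))"
      using maximal_class_above[OF a(1)] by blast
    then obtain c where c: "c \<in> Q" "a' - a - c \<in> ZZ F"
      unfolding lower_def by blast
    then obtain u v where uv: "a' - a - c = u - v" "u \<in> NN F" "v \<in> NN F"
      unfolding ZZ_eq by blast
    define x where "x = a' + (b - a) + v"
    have "x - a' \<in> NN F"
      unfolding x_def using a(2) uv(3) NN_add[of "b - a" F v] by (simp add: algebra_simps)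
    moreover have "x - b = c + u"
      unfolding x_def using uv(1) by (simp add: algebra_simps)
    then have "x - b \<in> Q"
      using c(1) uv(2) face_NN_Q[OF F] by (auto intro: NN_add)
    ultimately have "b \<in> component_std F"
      unfolding component_std_def mem_pair_set[symmetric] using a' b std_subset by blast
    then show "b \<in> (\<Union>F\<in>standard_faces A I. component_std F)"
      using a'(1) standard_faces_iff by blast
  qed
qed

lemma Inter_components:
  assumes "\<F> \<subseteq> standard_faces A I"
  shows "carrier (semigroup_ring A) \<inter> (\<Inter>F\<in>\<F>. face_component A I F)
    = monomial_span (Q - (\<Union>F\<in>\<F>. component_std F))"
  unfolding face_component_eq semigroup_ring_simps by (auto simp: monomial_span_def)

lemma I_eq: "I = monomial_span (Q - std A I)"
  by (rule monomial_ideal_eq(2)[OF monomial])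

section \<open>The decomposition and the associated primes\<close>

text \<open>Take a standard pair \<open>(a, F)\<close> and go from \<open>a\<close> far into the interior of the face, along the sum \<open>\<sigma>\<close> of
its generators. If \<open>F\<close> is not contained in \<open>G\<close>, a large multiple of \<open>\<sigma>\<close> has left the component of
\<open>G\<close>; if \<open>G\<close> strictly contains \<open>F\<close>, already \<open>a\<close> is not a base point for \<open>G\<close>.\<close>

lemma component_std_not_covered:
  assumes F: "F \<in> standard_faces A I"
  obtains x where "x \<in> std A I" "\<And>G. G \<in> standard_faces A I - {F} \<Longrightarrow> x \<notin> component_std G"
proof -
  obtain a where a: "standard_pair A I (a, F)"
    using F standard_faces_iff by blast
  note face_F = standard_pair_face[OF a]
  define \<sigma> where "\<sigma> = (\<Sum>f\<in>F. f)"
  have \<sigma>F: "\<sigma> \<in> NN F"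
    unfolding \<sigma>_def using NN_gen[OF face_finite[OF face_F]] by (intro NN_sum)
  then have \<sigma>Q: "\<sigma> \<in> Q"
    using face_NN_Q[OF face_F] by blast
  have \<sigma>G: "\<sigma> \<notin> NN G" if G: "divisor_closed_face G" and FG: "\<not> F \<subseteq> G" for G
  proof
    assume "\<sigma> \<in> NN G"
    obtain f where f: "f \<in> F" "f \<notin> G"
      using FG by blast
    have fA: "f \<in> A"
      using f(1) face_subset[OF face_F] by blast
    have "\<sigma> = f + (\<Sum>f\<in>F - {f}. f)"
      unfolding \<sigma>_def using face_finite[OF face_F] f(1) by (rule sum.remove)
    moreover have "(\<Sum>f\<in>F - {f}. f) \<in> Q"
      using face_subset[OF face_F] NN_gen[OF finite_A] by (intro NN_sum) auto
    ultimately have "f \<in> NN G"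
      using face_summand[OF G NN_gen[OF finite_A fA]] \<open>\<sigma> \<in> NN G\<close> by simp
    then show False
      using face_gen_iff[OF G fA] f(2) by blast
  qed
  have "\<forall>G\<in>standard_faces A I. \<exists>n. \<not> F \<subseteq> G \<longrightarrow> int n *s \<sigma> \<notin> component_std G"
    using component_std_power_escape[OF standard_faces_face \<sigma>Q] \<sigma>G standard_faces_face by metis
  then obtain N where N: "\<And>G. G \<in> standard_faces A I \<Longrightarrow> \<not> F \<subseteq> G \<Longrightarrow> int (N G) *s \<sigma> \<notin> component_std G"
    by metis
  define n where "n = (\<Sum>G\<in>standard_faces A I. N G)"
  show thesis
  proof (rule that)
    show "a + int n *s \<sigma> \<in> std A I"
      using standard_pair_base[OF a] NN_scale[OF \<sigma>F] by (auto simp: bases_def)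
    fix G assume G: "G \<in> standard_faces A I - {F}"
    note face_G = standard_faces_face[of G]
    show "a + int n *s \<sigma> \<notin> component_std G"
    proof
      assume *: "a + int n *s \<sigma> \<in> component_std G"
      show False
      proof (cases "F \<subseteq> G")
        case True
        have "a \<in> bases G"
          using bases_divisor[of G "a + int n *s \<sigma>" a] component_std_bases[OF *] face_G G
            standard_pair_Q[OF a] NN_scale[OF \<sigma>Q] by simp
        then show False
          using standard_pair_isolated[OF a] True face_G G unfolding isolated_def by blast
      next
        case False
        have "N G \<le> n"
          unfolding n_def using finite_standard_faces G by (intro member_le_sum) auto
        then have "int (N G) *s \<sigma> + (a + int (n - N G) *s \<sigma>) = a + int n *s \<sigma>"
          by (simp add: of_nat_diff vector_sub_rdistrib)
        then have "int (N G) *s \<sigma> + (a + int (n - N G) *s \<sigma>) \<in> component_std G"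
          using * by (simp only:)
        then have "int (N G) *s \<sigma> \<in> component_std G"
          by (rule component_std_divisor[rotated 2])
            (intro NN_add NN_scale standard_pair_Q[OF a] \<sigma>Q)+
        then show False
          using N False G by blast
      qed
    qed
  qed
qed

lemma decomposition:
  "irredundant_primary_decomposition I (standard_faces A I) (face_component A I) (semigroup_ring A)"
  unfolding irredundant_primary_decomposition_def
proof (intro conjI ballI)
  show "finite (standard_faces A I)"
    by (rule finite_standard_faces)
  show "primary_ideal (face_component A I F) (semigroup_ring A)" if "F \<in> standard_faces A I" for F
    using face_component_primary[OF that] by (simp add: primary_to_def)
  show "I = carrier (semigroup_ring A) \<inter> (\<Inter>F\<in>standard_faces A I. face_component A I F)"
    using I_eq Inter_components[OF subset_refl] std_eq_Union_components by simp
  show "inj_on (\<lambda>F. radical_ideal (semigroup_ring A) (face_component A I F)) (standard_faces A I)"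
  proof (rule inj_onI)
    fix F G assume FG: "F \<in> standard_faces A I" "G \<in> standard_faces A I"
      and "radical_ideal (semigroup_ring A) (face_component A I F)
        = radical_ideal (semigroup_ring A) (face_component A I G)"
    then have "(face_prime A F :: (int ^ 'd \<Rightarrow>\<^sub>0 'k) set) = face_prime A G"
      using face_component_primary by (simp add: primary_to_def)
    then show "F = G"
      using face_prime_subset_iff[of F G, where 'k = 'k] face_prime_subset_iff[of G F, where 'k = 'k]
        standard_faces_face FG by blast
  qed
  show "I \<noteq> carrier (semigroup_ring A) \<inter> (\<Inter>G\<in>standard_faces A I - {F}. face_component A I G)"
    if "F \<in> standard_faces A I" for F
  proof
    assume eq: "I = carrier (semigroup_ring A) \<inter> (\<Inter>G\<in>standard_faces A I - {F}. face_component A I G)"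
    obtain x where x: "x \<in> std A I" "\<And>G. G \<in> standard_faces A I - {F} \<Longrightarrow> x \<notin> component_std G"
      using component_std_not_covered[OF \<open>F \<in> standard_faces A I\<close>] by blast
    then have "(mon x :: int ^ 'd \<Rightarrow>\<^sub>0 'k) \<in> monomial_span (Q - (\<Union>G\<in>standard_faces A I - {F}. component_std G))"
      using std_subset by auto
    then have "mon x \<in> I"
      using eq Inter_components[of "standard_faces A I - {F}"] by blast
    then show False
      using x(1) by (simp add: std_def)
  qed
qed

text \<open>Let \<open>(a, F)\<close> have maximal class. For \<open>c \<in> A - F\<close> the point \<open>a + c\<close> is not a base point for \<open>F\<close>, as it
would lie in a standard pair whose class \<open>(a, F)\<close> divides properly. So some \<open>f c \<in> NN F\<close> moves
\<open>a + c\<close> out of the standard exponents. After adding all these \<open>f c\<close> to \<open>a\<close>, the annihilator of the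
resulting monomial modulo \<open>I\<close> is the face prime.\<close>

lemma standard_face_associated:
  assumes "F \<in> standard_faces A I"
  shows "associated_prime (face_prime A F) I (semigroup_ring A)"
proof -
  obtain a where a: "standard_pair A I (a, F)" "maximal_class A I (overlap_class A (a, F))"
    using maximal_class_above assms unfolding standard_faces_iff by metis
  note F = standard_pair_face[OF a(1)]
  have "\<exists>f\<in>NN F. a + c + f \<notin> std A I" if c: "c \<in> A - F" for c
  proof (rule ccontr)
    have cQ: "c \<in> Q"
      using c NN_gen[OF finite_A] by blast
    assume "\<not> (\<exists>f\<in>NN F. a + c + f \<notin> std A I)"
    then have "a + c \<in> bases F"
      unfolding bases_def using standard_pair_Q[OF a(1)] cQ by (auto intro: NN_add)
    then obtain b G where b: "standard_pair A I (b, G)" "F \<subseteq> G" "a + c - b \<in> NN G"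
      using proper_pair_in_standard_pair[OF F] by blast
    note G = standard_pair_face[OF b(1)]
    have "a \<in> bases G"
      using bases_saturated[OF G standard_pair_Q[OF a(1)] cQ standard_pair_base[OF b(1)] NN_ZZ[OF b(3)]] .
    then have GF: "G = F"
      using standard_pair_isolated[OF a(1)] b(2) G unfolding isolated_def by blast
    have acb: "a + c - b \<in> ZZ F"
      using NN_ZZ[OF b(3)] GF by simp
    then have "a \<in> lower F b"
      using ZZ_uminus[OF acb] cQ by (auto intro!: lowerI[of c] simp: algebra_simps)
    then have "b - a \<in> ZZ F"
      using maximal_class_iff[OF a(1)] a(2) b(1) GF by blast
    then have "(a + c - b) + (b - a) \<in> ZZ F"
      using acb ZZ_add by blast
    then have "c \<in> NN F"
      using face_ZZ_Q[OF F cQ] by simp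
    then show False
      using c face_gen_iff[OF F] by blast
  qed
  then obtain f where f: "\<And>c. c \<in> A - F \<Longrightarrow> f c \<in> NN F" "\<And>c. c \<in> A - F \<Longrightarrow> a + c + f c \<notin> std A I"
    by metis
  define e where "e = a + (\<Sum>c\<in>A - F. f c)"
  have "(\<Sum>c\<in>A - F. f c) \<in> NN F"
    using f(1) by (rule NN_sum)
  then have eF: "e + y \<in> std A I" if "y \<in> NN F" for y
    using standard_pair_base[OF a(1)] NN_add that by (auto simp: e_def bases_def add.assoc)
  then have eQ: "e \<in> Q"
    using eF[OF zero_NN] std_subset by auto
  have kill: "x + e \<in> Q - std A I" if x: "x \<in> Q - NN F" for x
  proof -
    obtain c where c: "c \<in> A - F" "x - c \<in> Q"
      using nonface_divisor[OF F] x by blast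
    have "(\<Sum>c\<in>A - F. f c) = f c + (\<Sum>c\<in>A - F - {c}. f c)"
      using finite_A c(1) by (intro sum.remove) auto
    then have eq: "(a + c + f c) + ((\<Sum>c\<in>A - F - {c}. f c) + (x - c)) = x + e"
      by (simp add: e_def)
    have "a + c + f c \<in> Q" "(\<Sum>c\<in>A - F - {c}. f c) + (x - c) \<in> Q"
      using f(1) face_NN_Q[OF F] c standard_pair_Q[OF a(1)] NN_gen[OF finite_A]
      by (auto intro!: NN_add NN_sum)
    then have "x + e \<notin> std A I"
      using std_divisor f(2)[OF c(1)] eq by metis
    then show ?thesis
      using x eQ NN_add by blast
  qed
  have mon_e: "(mon e :: int ^ 'd \<Rightarrow>\<^sub>0 'k) \<in> monomial_span {e}"
    by simp
  have sub: "g * mon e \<in> I" if "g \<in> monomial_span (Q - NN F)" for g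
    by (subst I_eq, rule monomial_span_mult[OF that mon_e]) (use kill in auto)
  \<comment> \<open>The terms of \<open>g\<close> on \<open>NN F\<close> are sent by \<open>mon e\<close> to standard exponents, so they must vanish.\<close>
  have sup: "g \<in> monomial_span (Q - NN F)" if g: "g \<in> monomial_span Q" "g * mon e \<in> I" for g
  proof -
    define g0 where "g0 = terms_in (NN F) g"
    have g0: "g0 \<in> monomial_span (NN F)" "g - g0 \<in> monomial_span (Q - NN F)"
      using terms_in_monomial_span[OF g(1), of "NN F"] monomial_span_mono[of "Q \<inter> NN F" "NN F"]
        minus_terms_in_monomial_span[OF g(1), of "NN F"] unfolding g0_def by auto
    have "g * mon e - (g - g0) * mon e \<in> monomial_span (Q - std A I)"
      using g(2) sub[OF g0(2)] I_eq monomial_span_diff by blast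
    then have "g0 * mon e \<in> monomial_span (Q - std A I)"
      by (simp add: algebra_simps)
    moreover have "g0 * mon e \<in> monomial_span (std A I)"
      by (rule monomial_span_mult[OF g0(1) mon_e]) (use eF in \<open>auto simp: add.commute\<close>)
    ultimately have "g0 * mon e = 0"
      by (rule monomial_span_disjoint) blast
    moreover have "(mon e :: int ^ 'd \<Rightarrow>\<^sub>0 'k) \<noteq> 0"
      by (metis mon_in_monomial_span monomial_span_0 empty_iff)
    ultimately have "g0 = 0"
      using laurent_eq_zero_of_mult by blast
    then show ?thesis
      using g0(2) by simp
  qed
  have "face_prime A F = {g \<in> carrier (semigroup_ring A). g \<otimes>\<^bsub>semigroup_ring A\<^esub> mon e \<in> I}"
    unfolding face_prime_eq[OF F] semigroup_ring_simps
    using sub sup monomial_span_mono[of "Q - NN F" Q] by blast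
  moreover have "(mon e :: int ^ 'd \<Rightarrow>\<^sub>0 'k) \<in> carrier (semigroup_ring A)"
    using eQ by simp
  ultimately show ?thesis
    unfolding associated_prime_def using face_prime_primeideal[OF F] by blast
qed

text \<open>Let \<open>face_prime A F\<close> be the annihilator of \<open>f\<close> modulo \<open>I\<close>, and \<open>X\<close> the set of faces whose component does
not contain \<open>f\<close>. For \<open>G \<in> X\<close> the annihilator of \<open>f\<close> modulo the component lies in its radical, so
\<open>G \<subseteq> F\<close>. If no \<open>G \<in> X\<close> contained \<open>F\<close>, each of these components would contain a monomial with
exponent in \<open>NN F\<close>, and the product of these monomials would multiply \<open>f\<close> into \<open>I\<close> without being in
the face prime.\<close>

lemma associated_standard_face:
  assumes F: "divisor_closed_face F" and "associated_prime (face_prime A F) I (semigroup_ring A)"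
  shows "F \<in> standard_faces A I"
proof -
  let ?C = "face_component A I"
  obtain f where f: "f \<in> monomial_span Q" and P: "face_prime A F = {g \<in> monomial_span Q. g * f \<in> I}"
    using assms(2) unfolding associated_prime_def semigroup_ring_simps by blast
  define X where "X = {G \<in> standard_faces A I. f \<notin> ?C G}"
  have face: "divisor_closed_face G" if "G \<in> X" for G
    using that standard_faces_face by (simp add: X_def)
  have I_C: "I = monomial_span Q \<inter> (\<Inter>G\<in>standard_faces A I. ?C G)"
    using decomposition unfolding irredundant_primary_decomposition_def by simp
  have "G \<subseteq> F" if G: "G \<in> X" for G
  proof -
    have prim: "primary_to (face_prime A G) (?C G) (semigroup_ring A)"
      using face_component_primary G by (simp add: X_def)
    have "x \<in> face_prime A G" if "x \<in> face_prime A F" for x :: "int ^ 'd \<Rightarrow>\<^sub>0 'k"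
    proof -
      have x: "x \<in> monomial_span Q" "f * x \<in> ?C G"
        using that P I_C G unfolding X_def by (auto simp: mult.commute)
      then have "\<exists>n>0. x ^ n \<in> ?C G"
        using prim f G unfolding primary_to_def primary_ideal_def semigroup_ring_simps
          semigroup_ring_pow X_def by blast
      then have "x \<in> radical_ideal (semigroup_ring A) (?C G)"
        using x(1) unfolding radical_ideal_def semigroup_ring_simps semigroup_ring_pow by blast
      then show ?thesis
        using prim by (simp add: primary_to_def)
    qed
    then show ?thesis
      using face_prime_subset_iff[OF F face[OF G], where 'k = 'k] by blast
  qed
  moreover have "\<exists>G\<in>X. F \<subseteq> G"
  proof (rule ccontr)
    assume "\<not> (\<exists>G\<in>X. F \<subseteq> G)"
    then have "\<forall>G\<in>X. \<exists>c. c \<in> NN F \<and> c \<notin> component_std G"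
    proof (intro ballI)
      fix G assume "G \<in> X" "\<not> (\<exists>G\<in>X. F \<subseteq> G)"
      then obtain c where c: "c \<in> NN F" "c \<notin> NN G"
        using face_NN_subset_iff[OF F face] by blast
      obtain n where "int n *s c \<notin> component_std G"
        using component_std_power_escape[OF face[OF \<open>G \<in> X\<close>] _ c(2)] c(1) face_NN_Q[OF F] by blast
      then show "\<exists>c. c \<in> NN F \<and> c \<notin> component_std G"
        using NN_scale[OF c(1)] by blast
    qed
    then obtain c where c: "\<And>G. G \<in> X \<Longrightarrow> c G \<in> NN F" "\<And>G. G \<in> X \<Longrightarrow> c G \<notin> component_std G"
      by metis
    define w where "w = (\<Sum>G\<in>X. c G)"
    have finX: "finite X"
      using finite_standard_faces by (simp add: X_def)
    have w: "w \<in> NN F"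
      unfolding w_def using c(1) by (rule NN_sum)
    then have wQ: "w \<in> Q"
      using face_NN_Q[OF F] by blast
    have "mon w * f \<in> ?C G" if G: "G \<in> standard_faces A I" for G
    proof -
      have C: "ideal (?C G) (semigroup_ring A)"
        unfolding face_component_eq by (rule ideal_monomial_span[OF absorbing_component])
      show ?thesis
      proof (cases "f \<in> ?C G")
        case True
        then show ?thesis
          using semigroup_ring_idealD(4)[OF C] wQ by simp
      next
        case False
        then have "G \<in> X"
          using G by (simp add: X_def)
        then have "w = c G + (\<Sum>G\<in>X - {G}. c G)"
          unfolding w_def using finX by (intro sum.remove)
        moreover have "c G \<in> Q" "(\<Sum>G\<in>X - {G}. c G) \<in> Q"
          using c(1) face_NN_Q[OF F] \<open>G \<in> X\<close> by (auto intro!: NN_sum)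
        ultimately have "w \<notin> component_std G"
          using component_std_divisor c(2)[OF \<open>G \<in> X\<close>] by metis
        then have "mon w \<in> ?C G"
          using wQ unfolding face_component_eq by simp
        then show ?thesis
          using semigroup_ring_idealD(4)[OF C _ f] by (metis mult.commute)
      qed
    qed
    moreover have "mon w * f \<in> monomial_span Q"
      using wQ f by (intro semigroup_ring_mult) auto
    ultimately have "mon w * f \<in> I"
      using I_C by blast
    then have "(mon w :: int ^ 'd \<Rightarrow>\<^sub>0 'k) \<in> face_prime A F"
      unfolding P using wQ by simp
    then show False
      using w unfolding face_prime_eq[OF F] by simp
  qed
  ultimately have "F \<in> X"
    by (metis subset_antisym)
  then show ?thesis
    by (simp add: X_def)
qed

text \<open>If only \<open>F\<close> occurs, then \<open>I\<close> is its single component. Conversely, every associated prime of a primary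
ideal \<open>I\<close> lies between \<open>I\<close> and the radical of \<open>I\<close>, hence equals that radical.\<close>

lemma primary_iff:
  assumes F: "divisor_closed_face F" and "I \<noteq> monomial_span Q"
  shows "primary_to (face_prime A F) I (semigroup_ring A) \<longleftrightarrow> standard_faces A I \<subseteq> {F}"
proof
  assume sub: "standard_faces A I \<subseteq> {F}"
  have "standard_faces A I \<noteq> {}"
  proof
    assume "standard_faces A I = {}"
    then have "std A I = {}"
      using std_eq_Union_components by simp
    then show False
      using I_eq \<open>I \<noteq> monomial_span Q\<close> by simp
  qed
  then have "standard_faces A I = {F}"
    using sub by blast
  moreover from this have "I = face_component A I F"
    using I_eq std_eq_Union_components by (simp add: face_component_eq)
  ultimately show "primary_to (face_prime A F) I (semigroup_ring A)"
    using face_component_primary by (metis singletonI)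
next
  assume prim: "primary_to (face_prime A F) I (semigroup_ring A)"
  show "standard_faces A I \<subseteq> {F}"
  proof
    fix G assume G: "G \<in> standard_faces A I"
    note face_G = standard_faces_face[OF G]
    obtain f where f: "f \<in> monomial_span Q" and P: "face_prime A G = {g \<in> monomial_span Q. g * f \<in> I}"
      using standard_face_associated[OF G] unfolding associated_prime_def semigroup_ring_simps by blast
    interpret G: primeideal "face_prime A G" "semigroup_ring A :: (int ^ 'd \<Rightarrow>\<^sub>0 'k) ring"
      by (rule face_prime_primeideal[OF face_G])
    have I: "ideal I (semigroup_ring A)"
      using prim by (simp add: primary_to_def primary_ideal_def)
    have "f \<notin> I"
    proof
      assume "f \<in> I"
      then have "(face_prime A G :: (int ^ 'd \<Rightarrow>\<^sub>0 'k) set) = monomial_span Q"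
        unfolding P using semigroup_ring_idealD(4)[OF I] by blast
      then show False
        using G.I_notcarr by simp
    qed
    have "x \<in> face_prime A F" if "x \<in> face_prime A G" for x :: "int ^ 'd \<Rightarrow>\<^sub>0 'k"
    proof -
      have x: "x \<in> monomial_span Q" "f * x \<in> I"
        using that P by (auto simp: mult.commute)
      then have "\<exists>n>0. x ^ n \<in> I"
        using prim f \<open>f \<notin> I\<close> unfolding primary_to_def primary_ideal_def semigroup_ring_simps
          semigroup_ring_pow by blast
      then have "x \<in> radical_ideal (semigroup_ring A) I"
        using x(1) unfolding radical_ideal_def semigroup_ring_simps semigroup_ring_pow by blast
      then show ?thesis
        using prim by (simp add: primary_to_def)
    qed
    moreover have "x \<in> face_prime A G" if "x \<in> face_prime A F" for x :: "int ^ 'd \<Rightarrow>\<^sub>0 'k"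
    proof -
      have "x \<in> radical_ideal (semigroup_ring A) I"
        using that prim by (simp add: primary_to_def)
      then obtain n where x: "x \<in> monomial_span Q" "x ^ n \<in> I"
        unfolding radical_ideal_def semigroup_ring_simps semigroup_ring_pow by blast
      have IG: "I \<subseteq> face_prime A G"
        unfolding P using semigroup_ring_idealD(1)[OF I] semigroup_ring_idealD(4)[OF I _ f]
        by (auto simp: mult.commute)
      have "x \<in> face_prime A G" if "x ^ m \<in> face_prime A G" for m
        using that
      proof (induction m)
        case 0
        then have "\<one>\<^bsub>semigroup_ring A\<^esub> \<in> (face_prime A G :: (int ^ 'd \<Rightarrow>\<^sub>0 'k) set)"
          by simp
        then show ?case
          using G.one_imp_carrier G.I_notcarr by simp
      next
        case (Suc m)
        then show ?case
          using G.I_prime[of x "x ^ m"] x(1) power_in_span[OF x(1)] by auto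
      qed
      then show ?thesis
        using x(2) IG by blast
    qed
    ultimately have "(face_prime A F :: (int ^ 'd \<Rightarrow>\<^sub>0 'k) set) = face_prime A G"
      by blast
    then show "G \<in> {F}"
      using face_prime_subset_iff[OF F face_G, where 'k = 'k]
        face_prime_subset_iff[OF face_G F, where 'k = 'k] by blast
  qed
qed

end

theorem theorem3p8:
  fixes A :: "(int ^ 'd) set"
    and I :: "(int ^ 'd \<Rightarrow>\<^sub>0 'k::field) set"
  assumes "infinite (UNIV :: 'k set)"
    and "finite A" and "0 \<notin> A"
    and "ZZ A = UNIV"
    and "strongly_convex (cone_gen A)"
    and "monomial_ideal A I"
  shows "irredundant_primary_decomposition I (standard_faces A I) (face_component A I)
           (semigroup_ring A) \<and>
         (\<forall>F. is_face A F \<longrightarrow>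
           (associated_prime (face_prime A F) I (semigroup_ring A) \<longleftrightarrow>
            (\<exists>a. standard_pair A I (a, F)))) \<and>
         (\<forall>F. is_face A F \<and> I \<noteq> carrier (semigroup_ring A) \<longrightarrow>
           (primary_to (face_prime A F) I (semigroup_ring A) \<longleftrightarrow>
            (\<forall>p. standard_pair A I p \<longrightarrow> snd p = F)))"
proof -
  interpret monomial_ideal_of_semigroup A I
    by unfold_locales (use assms in auto)
  have "standard_faces A I \<subseteq> {F} \<longleftrightarrow> (\<forall>p. standard_pair A I p \<longrightarrow> snd p = F)" for F
    using standard_faces_iff by (auto simp: subset_iff)
  then have primary: "primary_to (face_prime A F) I (semigroup_ring A) \<longleftrightarrow>
      (\<forall>p. standard_pair A I p \<longrightarrow> snd p = F)"
    if "divisor_closed_face F" "I \<noteq> monomial_span Q" for F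
    using primary_iff[OF that] by (simp only:)
  have associated: "associated_prime (face_prime A F) I (semigroup_ring A) \<longleftrightarrow> F \<in> standard_faces A I"
    if "divisor_closed_face F" for F
    using standard_face_associated associated_standard_face[OF that] by (rule iffI[rotated])
  show ?thesis
    unfolding is_face_iff standard_faces_iff[symmetric] semigroup_ring_simps
    by (intro conjI allI impI decomposition; (elim conjE)?; rule associated primary; assumption)
qed

end
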